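(* Let $Y_0=S^2$, $K=S^1=\{\zeta\in\mathbb{C}:|\zeta|=1\}$, and $Y=Y_0\times K$. Let $\mathcal{G}_0=\mathrm{Homeo}_0(S^2)$ be the connected component of the identity in the Polish group $\mathrm{Homeo}(S^2)$. Let $U_1,U_2\subset Y_0$ be nonempty open sets with $\overline{U_1}\cap\overline{U_2}=\emptyset$, and let $\phi:Y_0\to[0,1]$ be a continuous function with $\phi(y)=1$ for $y\in U_1$ and $\phi(y)=0$ for $y\in U_2$. For $t\in\mathbb{R}$ let $\Phi_t$ be the homeomorphism of $Y$ given by $\Phi_t(y,\zeta)=(y,e^{i\pi t\phi(y)}\zeta)$. Let $\mathcal{G}$ be the subgroup of $\mathrm{Homeo}(Y)$ generated by the following three subgroups: (i) $\mathcal{G}_0$, acting on $Y$ by $g(y,\zeta)=(gy,\zeta)$; (ii) $\{\Phi_t: t\in\mathbb{R}\}$; (iii) $\mathrm{id}\times K$, where $k\in K$ acts by $(y,\zeta)\mapsto(y,k\zeta)$. Then the flow $(Y,\mathcal{G})$ is a PI-flow and its enveloping semigroup $E(Y,\mathcal{G})$ has exactly $2^{\mathfrak{c}}$ minimal left ideals, where $\mathfrak{c}=2^{\aleph_0}$.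
   Context: A flow $(X,G)$ is a compact Hausdorff space $X$ together with a continuous homomorphism of the topological group $G$ into the group $\mathrm{Homeo}(X)$ of self-homeomorphisms of $X$ (compact-open topology), written $(g,x)\mapsto gx$. It is minimal if every orbit $Gx$ is dense in $X$. A homomorphism of flows is a continuous $G$-equivariant map (automatically surjective when the target is minimal); one also calls it an extension of its target. The group $\mathcal{G}$ carries the topology inherited from $\mathrm{Homeo}(Y)$. Enveloping semigroup: $E(X,G)$ is the closure in $X^X$ (product topology) of the set of maps $\{x\mapsto gx : g\in G\}$; it is a semigroup under composition. A left ideal is a nonempty subset $I\subset E(X,G)$ with $E(X,G)\,I\subset I$; it is minimal if it contains no strictly smaller left ideal. Two points $x_1,x_2$ of a flow are proximal if there is a net $g_i\in G$ with $\lim g_ix_1=\lim g_ix_2$. An extension $\phi:W'\to W$ is proximal if any two points with the same image under $\phi$ are proximal. It is equicontinuous if, with $R_\phi=\{(a,b)\in W'\times W':\phi(a)=\phi(b)\}$, for every neighborhood $\alpha$ of the diagonal in $W'\times W'$ there is a neighborhood $\beta$ of the diagonal such that $(ga,gb)\in\alpha$ for all $g\in G$ and all $(a,b)\in\beta\cap R_\phi$ (for metrizable minimal flows such extensions are also called isometric). A minimal flow $(X,G)$ is strictly PI if there are an ordinal $\eta$ and a family of minimal flows $\{W_\iota\}_{\iota\le\eta}$ such that: $W_0$ is the trivial (one-point) flow; for every $\iota<\eta$ there is a homomorphism $\phi_\iota:W_{\iota+1}\to W_\iota$ which is either proximal or equicontinuous; for every limit ordinal $\nu\le\eta$, $W_\nu$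 is the inverse limit of $\{W_\iota\}_{\iota<\nu}$; and $W_\eta=X$. A minimal flow $(X,G)$ is a PI-flow (in particular it is minimal) if there exist a strictly PI flow $\tilde X$ and a proximal homomorphism $\theta:\tilde X\to X$. *)

theory Defs
  imports "HOL-Analysis.Analysis" "HOL-Library.Equipollence"
    "HOL-Algebra.Bij" "HOL-Algebra.Generated_Groups"
begin

section \<open>Homeomorphism groups\<close>

text \<open>Self-maps of a space are represented by functions that are extensional on its carrier,
  as in \<^const>\<open>BijGroup\<close>, so that equality of maps is equality of functions.\<close>

definition Homeo :: "'a topology \<Rightarrow> ('a \<Rightarrow> 'a) monoid" where
  "Homeo X = (BijGroup (topspace X))
     \<lparr>carrier := {f \<in> Bij (topspace X). homeomorphic_map X X f}\<rparr>"

definition compact_open_topology :: "'a topology \<Rightarrow> 'b topology \<Rightarrow> ('a \<Rightarrow> 'b) topology" where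
  "compact_open_topology X Y = topology_generated_by
     {{f \<in> extensional (topspace X). continuous_map X Y f \<and> f ` C \<subseteq> U} | C U.
        compactin X C \<and> openin Y U}"

definition homeo_topology :: "'a topology \<Rightarrow> ('a \<Rightarrow> 'a) topology" where
  "homeo_topology X = subtopology (compact_open_topology X X) (carrier (Homeo X))"

section \<open>Flows\<close>

definition topological_group :: "('g, 'm) monoid_scheme \<Rightarrow> 'g topology \<Rightarrow> bool" where
  "topological_group G T \<longleftrightarrow>
     group G \<and> topspace T = carrier G \<and>
     continuous_map (prod_topology T T) T (\<lambda>(g, h). g \<otimes>\<^bsub>G\<^esub> h) \<and>
     continuous_map T T (\<lambda>g. inv\<^bsub>G\<^esub> g)"

definition flow ::
  "('g, 'm) monoid_scheme \<Rightarrow> 'g topology \<Rightarrow> 'x topology \<Rightarrow> ('g \<Rightarrow> 'x \<Rightarrow> 'x) \<Rightarrow> bool" where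
  "flow G T X act \<longleftrightarrow>
     topological_group G T \<and> compact_space X \<and> Hausdorff_space X \<and>
     (\<lambda>g. restrict (act g) (topspace X)) \<in> hom G (Homeo X) \<and>
     continuous_map T (homeo_topology X) (\<lambda>g. restrict (act g) (topspace X))"

text \<open>Minimal flows are nonempty. Without this the empty flow would be vacuously minimal, and
  the inclusion of the empty flow a vacuous proximal homomorphism into every flow.\<close>

definition minimal_flow ::
  "('g, 'm) monoid_scheme \<Rightarrow> 'g topology \<Rightarrow> 'x topology \<Rightarrow> ('g \<Rightarrow> 'x \<Rightarrow> 'x) \<Rightarrow> bool" where
  "minimal_flow G T X act \<longleftrightarrow>
     flow G T X act \<and> topspace X \<noteq> {} \<and>
     (\<forall>x \<in> topspace X. X closure_of {act g x | g. g \<in> carrier G} = topspace X)"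

definition flow_hom ::
  "('g, 'm) monoid_scheme \<Rightarrow> 'x topology \<Rightarrow> ('g \<Rightarrow> 'x \<Rightarrow> 'x) \<Rightarrow>
     'y topology \<Rightarrow> ('g \<Rightarrow> 'y \<Rightarrow> 'y) \<Rightarrow> ('x \<Rightarrow> 'y) \<Rightarrow> bool" where
  "flow_hom G X a Y b f \<longleftrightarrow>
     continuous_map X Y f \<and> (\<forall>g \<in> carrier G. \<forall>x \<in> topspace X. f (a g x) = b g (f x))"

text \<open>Nets in the group are rendered by proper filters that contain its carrier.\<close>

definition proximal_points ::
  "('g, 'm) monoid_scheme \<Rightarrow> 'x topology \<Rightarrow> ('g \<Rightarrow> 'x \<Rightarrow> 'x) \<Rightarrow> 'x \<Rightarrow> 'x \<Rightarrow> bool" where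
  "proximal_points G X act x1 x2 \<longleftrightarrow>
     (\<exists>F z. F \<noteq> bot \<and> eventually (\<lambda>g. g \<in> carrier G) F \<and>
        limitin X (\<lambda>g. act g x1) z F \<and> limitin X (\<lambda>g. act g x2) z F)"

definition proximal_extension ::
  "('g, 'm) monoid_scheme \<Rightarrow> 'x topology \<Rightarrow> ('g \<Rightarrow> 'x \<Rightarrow> 'x) \<Rightarrow>
     'y topology \<Rightarrow> ('g \<Rightarrow> 'y \<Rightarrow> 'y) \<Rightarrow> ('x \<Rightarrow> 'y) \<Rightarrow> bool" where
  "proximal_extension G X a Y b f \<longleftrightarrow>
     flow_hom G X a Y b f \<and>
     (\<forall>x1 \<in> topspace X. \<forall>x2 \<in> topspace X. f x1 = f x2 \<longrightarrow> proximal_points G X a x1 x2)"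

definition diagonal_nhd :: "'x topology \<Rightarrow> ('x \<times> 'x) set \<Rightarrow> bool" where
  "diagonal_nhd X \<alpha> \<longleftrightarrow>
     \<alpha> \<subseteq> topspace X \<times> topspace X \<and>
     (\<exists>U. openin (prod_topology X X) U \<and> (\<forall>x \<in> topspace X. (x, x) \<in> U) \<and> U \<subseteq> \<alpha>)"

definition equicontinuous_extension ::
  "('g, 'm) monoid_scheme \<Rightarrow> 'x topology \<Rightarrow> ('g \<Rightarrow> 'x \<Rightarrow> 'x) \<Rightarrow>
     'y topology \<Rightarrow> ('g \<Rightarrow> 'y \<Rightarrow> 'y) \<Rightarrow> ('x \<Rightarrow> 'y) \<Rightarrow> bool" where
  "equicontinuous_extension G X a Y b f \<longleftrightarrow>
     flow_hom G X a Y b f \<and>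
     (\<forall>\<alpha>. diagonal_nhd X \<alpha> \<longrightarrow>
        (\<exists>\<beta>. diagonal_nhd X \<beta> \<and>
           (\<forall>g \<in> carrier G. \<forall>(x, y) \<in> \<beta>. f x = f y \<longrightarrow> (a g x, a g y) \<in> \<alpha>)))"

section \<open>PI-flows\<close>

text \<open>A tower is indexed by the field of a well-order \<open>r\<close> with greatest element \<open>\<eta>\<close>, which
  stands for the set of ordinals up to \<open>\<eta>\<close>. The maps \<open>p j i : W j \<rightarrow> W i\<close> for \<open>i \<le> j\<close> are the
  \<open>\<phi>\<^sub>\<iota>\<close>, their composites, and the projections of the inverse limits. The three clauses at the
  end treat the first index, successor indices (\<open>underS r j = under r i\<close> says that \<open>j\<close> is the
  successor of \<open>i\<close>), and limit indices.\<close>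

definition limit_index :: "'i rel \<Rightarrow> 'i \<Rightarrow> bool" where
  "limit_index r n \<longleftrightarrow>
     n \<in> Field r \<and> underS r n \<noteq> {} \<and> (\<forall>i \<in> Field r. underS r n \<noteq> under r i)"

definition inverse_limit ::
  "'i rel \<Rightarrow> 'i set \<Rightarrow> ('i \<Rightarrow> 'w topology) \<Rightarrow> ('i \<Rightarrow> 'i \<Rightarrow> 'w \<Rightarrow> 'w) \<Rightarrow> ('i \<Rightarrow> 'w) topology" where
  "inverse_limit r I W p = subtopology (product_topology W I)
     {x. \<forall>i \<in> I. \<forall>j \<in> I. (i, j) \<in> r \<longrightarrow> p j i (x j) = x i}"

definition PI_tower ::
  "('g, 'm) monoid_scheme \<Rightarrow> 'g topology \<Rightarrow> 'i rel \<Rightarrow> 'i \<Rightarrow> ('i \<Rightarrow> 'w topology) \<Rightarrow>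
     ('i \<Rightarrow> 'g \<Rightarrow> 'w \<Rightarrow> 'w) \<Rightarrow> ('i \<Rightarrow> 'i \<Rightarrow> 'w \<Rightarrow> 'w) \<Rightarrow> bool" where
  "PI_tower G T r \<eta> W a p \<longleftrightarrow>
     Well_order r \<and> \<eta> \<in> Field r \<and> (\<forall>i \<in> Field r. (i, \<eta>) \<in> r) \<and>
     (\<forall>i \<in> Field r. minimal_flow G T (W i) (a i)) \<and>
     (\<forall>i j. (i, j) \<in> r \<longrightarrow> flow_hom G (W j) (a j) (W i) (a i) (p j i)) \<and>
     (\<forall>i \<in> Field r. \<forall>x \<in> topspace (W i). p i i x = x) \<and>
     (\<forall>i j k. (i, j) \<in> r \<longrightarrow> (j, k) \<in> r \<longrightarrow>
        (\<forall>x \<in> topspace (W k). p j i (p k j x) = p k i x)) \<and>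
     (\<forall>i \<in> Field r. underS r i = {} \<longrightarrow> (\<exists>x. topspace (W i) = {x})) \<and>
     (\<forall>i \<in> Field r. \<forall>j \<in> Field r. underS r j = under r i \<longrightarrow>
        proximal_extension G (W j) (a j) (W i) (a i) (p j i) \<or>
        equicontinuous_extension G (W j) (a j) (W i) (a i) (p j i)) \<and>
     (\<forall>n. limit_index r n \<longrightarrow>
        homeomorphic_map (W n) (inverse_limit r (underS r n) W p)
          (\<lambda>x. \<lambda>i \<in> underS r n. p n i x))"

text \<open>HOL cannot quantify over all types, but taking the flows \<open>W i\<close> and the indices in the
  type \<open>'w\<close> of \<open>X\<close> loses nothing. Every \<open>W i\<close> is a factor of \<open>X\<close>, so it can be copied onto a set
  of representatives. Merging stages at which the factor does not change leaves a tower whose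
  kernel relations on \<open>X\<close> strictly decrease, and such a chain has at most
  \<open>|X|\<close> terms if \<open>X\<close> is finite and at most \<open>|X \<times> X| = |X|\<close> terms otherwise.\<close>

definition strictly_PI ::
  "('g, 'm) monoid_scheme \<Rightarrow> 'g topology \<Rightarrow> 'w topology \<Rightarrow> ('g \<Rightarrow> 'w \<Rightarrow> 'w) \<Rightarrow> bool" where
  "strictly_PI G T X act \<longleftrightarrow>
     minimal_flow G T X act \<and>
     (\<exists>(r :: 'w rel) \<eta> W a p. PI_tower G T r \<eta> W a p \<and> W \<eta> = X \<and> a \<eta> = act)"

text \<open>Likewise, every minimal flow of \<open>G\<close> has an isomorphic copy on the type \<open>'g set set\<close>: in a
  Hausdorff space with a dense orbit \<open>G x\<^sub>0\<close> the map that sends \<open>x\<close> to the set of all \<open>A \<subseteq> G\<close> such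
  that \<open>x\<close> lies in the closure of \<open>A x\<^sub>0\<close> is injective.\<close>

definition PI_flow ::
  "('g, 'm) monoid_scheme \<Rightarrow> 'g topology \<Rightarrow> 'x topology \<Rightarrow> ('g \<Rightarrow> 'x \<Rightarrow> 'x) \<Rightarrow> bool" where
  "PI_flow G T X act \<longleftrightarrow>
     minimal_flow G T X act \<and>
     (\<exists>(X' :: 'g set set topology) act' \<theta>.
        strictly_PI G T X' act' \<and> proximal_extension G X' act' X act \<theta>)"

section \<open>Enveloping semigroups\<close>

definition enveloping_semigroup ::
  "('g, 'm) monoid_scheme \<Rightarrow> 'x topology \<Rightarrow> ('g \<Rightarrow> 'x \<Rightarrow> 'x) \<Rightarrow> ('x \<Rightarrow> 'x) set" where
  "enveloping_semigroup G X act =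
     product_topology (\<lambda>_. X) (topspace X) closure_of
       {restrict (act g) (topspace X) | g. g \<in> carrier G}"

definition left_ideal ::
  "('g, 'm) monoid_scheme \<Rightarrow> 'x topology \<Rightarrow> ('g \<Rightarrow> 'x \<Rightarrow> 'x) \<Rightarrow> ('x \<Rightarrow> 'x) set \<Rightarrow> bool" where
  "left_ideal G X act I \<longleftrightarrow>
     I \<noteq> {} \<and> I \<subseteq> enveloping_semigroup G X act \<and>
     (\<forall>p \<in> enveloping_semigroup G X act. \<forall>q \<in> I. compose (topspace X) p q \<in> I)"

definition minimal_left_ideal ::
  "('g, 'm) monoid_scheme \<Rightarrow> 'x topology \<Rightarrow> ('g \<Rightarrow> 'x \<Rightarrow> 'x) \<Rightarrow> ('x \<Rightarrow> 'x) set \<Rightarrow> bool" where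
  "minimal_left_ideal G X act I \<longleftrightarrow>
     left_ideal G X act I \<and> (\<forall>J. left_ideal G X act J \<longrightarrow> \<not> J \<subset> I)"

section \<open>The group acting on the product of the sphere and the circle\<close>

abbreviation S2 :: "(real ^ 3) topology" where
  "S2 \<equiv> top_of_set (sphere 0 1)"

abbreviation S1 :: "complex topology" where
  "S1 \<equiv> top_of_set (sphere 0 1)"

abbreviation Y :: "((real ^ 3) \<times> complex) topology" where
  "Y \<equiv> prod_topology S2 S1"

definition Homeo0_S2 :: "(real ^ 3 \<Rightarrow> real ^ 3) set" where
  "Homeo0_S2 = connected_component_of_set (homeo_topology S2) \<one>\<^bsub>Homeo S2\<^esub>"

definition Phi :: "(real ^ 3 \<Rightarrow> real) \<Rightarrow> real \<Rightarrow> (real ^ 3) \<times> complex \<Rightarrow> (real ^ 3) \<times> complex" where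
  "Phi \<phi> t = (\<lambda>(y, \<zeta>) \<in> topspace Y. (y, exp (\<i> * of_real (pi * t * \<phi> y)) * \<zeta>))"

definition GY :: "(real ^ 3 \<Rightarrow> real) \<Rightarrow> ((real ^ 3) \<times> complex \<Rightarrow> (real ^ 3) \<times> complex) monoid" where
  "GY \<phi> = subgroup_generated (Homeo Y)
     ({(\<lambda>(y, \<zeta>) \<in> topspace Y. (g y, \<zeta>)) | g. g \<in> Homeo0_S2} \<union>
      {Phi \<phi> t | t. t \<in> UNIV} \<union>
      {(\<lambda>(y, \<zeta>) \<in> topspace Y. (y, k * \<zeta>)) | k. k \<in> topspace S1})"

definition GY_topology ::
  "(real ^ 3 \<Rightarrow> real) \<Rightarrow> ((real ^ 3) \<times> complex \<Rightarrow> (real ^ 3) \<times> complex) topology" where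
  "GY_topology \<phi> = subtopology (homeo_topology Y) (carrier (GY \<phi>))"

end

theory Submission
  imports Defs
begin

text \<open>
  The whole argument rests on one property of the group (lemma \<open>GY_collapses\<close>): given finitely many
  points of the sphere, a set \<open>A\<close>, a nonempty open set \<open>V\<close>, and a unit \<open>k\<close>, some group element
  moves all these points into \<open>V\<close> and at the same time multiplies the fibre coordinate by \<open>-k\<close> over
  those in \<open>A\<close> and by \<open>k\<close> over the others. For this the points in \<open>A\<close> are moved into \<open>U1\<close> and the
  others into \<open>U2\<close>; then \<open>\<Phi>\<^sub>1\<close> changes the sign over the former only; and finally everything is
  moved into \<open>V\<close>. Homeomorphisms of the sphere that move finitely many points into prescribed
  open sets can be taken with support in a disc, and the Alexander trick connects such a
  homeomorphism to the identity (lemma \<open>Homeo0_S2_moves_finite_sets\<close>).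

  The flow is a PI-flow because of the tower \<open>Y \<rightarrow> S2 \<rightarrow> pt\<close>. All group elements are skew products
  \<open>(y, \<zeta>) \<mapsto> (h y, c y * \<zeta>)\<close> with \<open>c y\<close> in the circle, so that the fibres of \<open>Y \<rightarrow> S2\<close> are moved
  isometrically, and any two points of the sphere are proximal (lemma \<open>PI_flow_Y\<close>). That the stages
  are flows at all is a general fact: homeomorphism groups of compact Hausdorff spaces are
  topological groups in the compact-open topology, and equivariant Hausdorff quotients of flows are
  flows (lemmas \<open>topological_group_Homeo\<close> and \<open>flow_factor\<close>).

  Passing to pointwise limits, the enveloping semigroup contains for \<^emph>\<open>every\<close> set \<open>A\<close> of points of
  the sphere the maps \<open>(y, \<zeta>) \<mapsto> (z, \<plusminus>k * \<zeta>)\<close>, where the sign is negative exactly over \<open>A\<close>. For fixed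
  \<open>A\<close> these maps form a minimal left ideal (lemma \<open>minimal_left_ideal_collapses\<close>): elements of the
  semigroup commute with the rotations of the fibres, so that composing on the left changes only
  \<open>z\<close> and \<open>k\<close>, and changes them arbitrarily. Sets \<open>A\<close> that miss a common base point give different
  ideals, and there are \<open>2\<^sup>c\<close> such sets, where \<open>c\<close> is the cardinality of the continuum. Conversely,
  minimal left ideals are disjoint and the semigroup consists of self-maps of a set of cardinality
  \<open>c\<close>, of which there are \<open>2\<^sup>c\<close>.
\<close>

section \<open>Homeomorphism groups of compact Hausdorff spaces\<close>

lemma carrier_Homeo: "carrier (Homeo X) = {f \<in> Bij (topspace X). homeomorphic_map X X f}"
  by (simp add: Homeo_def)

lemma Homeo_imp_homeomorphic_map: "f \<in> carrier (Homeo X) \<Longrightarrow> homeomorphic_map X X f"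
  by (simp add: carrier_Homeo)

lemma Homeo_imp_continuous_map: "f \<in> carrier (Homeo X) \<Longrightarrow> continuous_map X X f"
  by (simp add: carrier_Homeo homeomorphic_imp_continuous_map)

lemma Homeo_imp_extensional: "f \<in> carrier (Homeo X) \<Longrightarrow> f \<in> extensional (topspace X)"
  by (simp add: carrier_Homeo Bij_def)

lemma Homeo_imp_bij_betw: "f \<in> carrier (Homeo X) \<Longrightarrow> bij_betw f (topspace X) (topspace X)"
  by (simp add: carrier_Homeo Bij_def)

lemma Homeo_closed: "f \<in> carrier (Homeo X) \<Longrightarrow> x \<in> topspace X \<Longrightarrow> f x \<in> topspace X"
  using Homeo_imp_bij_betw bij_betwE by blast

lemma HomeoI:
  assumes "homeomorphic_map X X f" and "f \<in> extensional (topspace X)"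
  shows "f \<in> carrier (Homeo X)"
  using assms homeomorphic_eq_everything_map[of X X f]
  by (auto simp: carrier_Homeo Bij_def bij_betw_def)

lemma homeomorphic_map_restrict:
  assumes "homeomorphic_map X X f"
  shows "restrict f (topspace X) \<in> carrier (Homeo X)"
  by (rule HomeoI) (rule homeomorphic_map_eq[OF assms], simp_all)

lemma mult_Homeo:
  assumes "f \<in> carrier (Homeo X)" and "g \<in> carrier (Homeo X)"
  shows "f \<otimes>\<^bsub>Homeo X\<^esub> g = compose (topspace X) f g"
  using assms by (simp add: Homeo_def BijGroup_def)

lemma one_Homeo: "\<one>\<^bsub>Homeo X\<^esub> = (\<lambda>x\<in>topspace X. x)"
  by (simp add: Homeo_def BijGroup_def)

text \<open>The carrier is a subgroup of the group of all bijections.\<close>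

lemma group_Homeo: "group (Homeo X)"
proof -
  interpret B: group "BijGroup (topspace X)" by (rule group_BijGroup)
  have "subgroup {f \<in> Bij (topspace X). homeomorphic_map X X f} (BijGroup (topspace X))"
  proof (rule B.subgroupI)
    show "{f \<in> Bij (topspace X). homeomorphic_map X X f} \<subseteq> carrier (BijGroup (topspace X))"
      by (auto simp: BijGroup_def)
    have "(\<lambda>x\<in>topspace X. x) \<in> Bij (topspace X)" by (rule id_Bij)
    moreover have "homeomorphic_map X X (\<lambda>x\<in>topspace X. x)"
      by (rule homeomorphic_map_eq[of X X id]) simp_all
    ultimately show "{f \<in> Bij (topspace X). homeomorphic_map X X f} \<noteq> {}" by blast
  next
    fix f assume f: "f \<in> {f \<in> Bij (topspace X). homeomorphic_map X X f}"
    obtain g where g: "homeomorphic_maps X X f g"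
      using f homeomorphic_map_maps by blast
    have eq: "(\<lambda>x\<in>topspace X. inv_into (topspace X) f x) x = g x" if "x \<in> topspace X" for x
    proof -
      have "inj_on f (topspace X)" using f by (auto simp: Bij_def bij_betw_def)
      moreover have "f (g x) = x" "g x \<in> topspace X"
        using g that by (auto simp: homeomorphic_maps_def continuous_map_def)
      ultimately show ?thesis using that by (metis inv_into_f_f restrict_apply')
    qed
    have "homeomorphic_map X X g"
      using g homeomorphic_maps_map by blast
    then have "homeomorphic_map X X (\<lambda>x\<in>topspace X. inv_into (topspace X) f x)"
      by (rule homeomorphic_map_eq) (use eq in simp)
    moreover have "inv\<^bsub>BijGroup (topspace X)\<^esub> f = (\<lambda>x\<in>topspace X. inv_into (topspace X) f x)"
      using f by (intro inv_BijGroup) auto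
    ultimately show "inv\<^bsub>BijGroup (topspace X)\<^esub> f \<in> {f \<in> Bij (topspace X). homeomorphic_map X X f}"
      using f by (auto simp: restrict_inv_into_Bij)
  next
    fix f g assume fg: "f \<in> {f \<in> Bij (topspace X). homeomorphic_map X X f}"
      "g \<in> {f \<in> Bij (topspace X). homeomorphic_map X X f}"
    then have "f \<otimes>\<^bsub>BijGroup (topspace X)\<^esub> g = compose (topspace X) f g"
      by (simp add: BijGroup_def)
    moreover have "homeomorphic_map X X (compose (topspace X) f g)"
      by (rule homeomorphic_map_eq[of X X "f \<circ> g"])
        (use fg homeomorphic_map_compose in \<open>auto simp: compose_def\<close>)
    ultimately show "f \<otimes>\<^bsub>BijGroup (topspace X)\<^esub> g \<in> {f \<in> Bij (topspace X). homeomorphic_map X X f}"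
      using fg by (auto simp: compose_Bij)
  qed
  then show ?thesis
    unfolding Homeo_def by (rule B.subgroup_imp_group)
qed

lemma inv_Homeo_cancel:
  assumes "f \<in> carrier (Homeo X)" and "x \<in> topspace X"
  shows "(inv\<^bsub>Homeo X\<^esub> f) (f x) = x" and "f ((inv\<^bsub>Homeo X\<^esub> f) x) = x"
proof -
  interpret group "Homeo X" by (rule group_Homeo)
  have "compose (topspace X) (inv\<^bsub>Homeo X\<^esub> f) f = (\<lambda>x\<in>topspace X. x)"
    "compose (topspace X) f (inv\<^bsub>Homeo X\<^esub> f) = (\<lambda>x\<in>topspace X. x)"
    using assms l_inv r_inv by (simp_all flip: mult_Homeo one_Homeo)
  then show "(inv\<^bsub>Homeo X\<^esub> f) (f x) = x" "f ((inv\<^bsub>Homeo X\<^esub> f) x) = x"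
    using assms(2) by (metis compose_eq restrict_apply')+
qed

subsection \<open>The compact-open topology\<close>

lemma topspace_compact_open:
  "topspace (compact_open_topology X Z) = {f \<in> extensional (topspace X). continuous_map X Z f}"
proof -
  have "{f \<in> extensional (topspace X). continuous_map X Z f} \<in>
      {{f \<in> extensional (topspace X). continuous_map X Z f \<and> f ` C \<subseteq> U} | C U.
        compactin X C \<and> openin Z U}"
    by (rule CollectI, rule exI[of _ "{}"], rule exI[of _ "{}"]) simp
  then show ?thesis
    unfolding compact_open_topology_def topology_generated_by_topspace by blast
qed

lemma openin_compact_open:
  assumes "compactin X C" and "openin Z U"
  shows "openin (compact_open_topology X Z)
    {f \<in> extensional (topspace X). continuous_map X Z f \<and> f ` C \<subseteq> U}"
  unfolding compact_open_topology_def
  by (rule topology_generated_by_Basis) (use assms in blast)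

lemma topspace_homeo_topology: "topspace (homeo_topology X) = carrier (Homeo X)"
  unfolding homeo_topology_def topspace_subtopology topspace_compact_open
  using Homeo_imp_continuous_map Homeo_imp_extensional by blast

lemma openin_homeo_topology:
  assumes "compactin X C" and "openin X U"
  shows "openin (homeo_topology X) {f \<in> carrier (Homeo X). f ` C \<subseteq> U}"
proof -
  have "{f \<in> carrier (Homeo X). f ` C \<subseteq> U} =
      {f \<in> extensional (topspace X). continuous_map X X f \<and> f ` C \<subseteq> U} \<inter> carrier (Homeo X)"
    using Homeo_imp_continuous_map Homeo_imp_extensional by blast
  then show ?thesis
    unfolding homeo_topology_def openin_subtopology
    using openin_compact_open[OF assms] by blast
qed

lemma continuous_map_into_homeo_topology:
  assumes F: "\<And>t. t \<in> topspace T \<Longrightarrow> F t \<in> carrier (Homeo X)"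
    and op: "\<And>C U. compactin X C \<Longrightarrow> openin X U \<Longrightarrow> openin T {t \<in> topspace T. F t ` C \<subseteq> U}"
  shows "continuous_map T (homeo_topology X) F"
  unfolding homeo_topology_def
proof (rule continuous_map_into_subtopology)
  show "F \<in> topspace T \<rightarrow> carrier (Homeo X)" using F by blast
  show "continuous_map T (compact_open_topology X X) F"
    unfolding compact_open_topology_def continuous_on_generated_topo_iff
  proof (intro conjI allI impI)
    fix V assume "V \<in> {{f \<in> extensional (topspace X). continuous_map X X f \<and> f ` C \<subseteq> U} |C U.
      compactin X C \<and> openin X U}"
    then obtain C U where CU: "compactin X C" "openin X U"
      and V: "V = {f \<in> extensional (topspace X). continuous_map X X f \<and> f ` C \<subseteq> U}" by blast
    have "F -` V \<inter> topspace T = {t \<in> topspace T. F t ` C \<subseteq> U}"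
      using F Homeo_imp_continuous_map Homeo_imp_extensional unfolding V by blast
    then show "openin T (F -` V \<inter> topspace T)" using op[OF CU] by simp
  next
    have "F ` topspace T \<subseteq> topspace (compact_open_topology X X)"
      using F Homeo_imp_continuous_map Homeo_imp_extensional
      unfolding topspace_compact_open by blast
    then show "F ` topspace T \<subseteq> \<Union> {{f \<in> extensional (topspace X). continuous_map X X f \<and> f ` C \<subseteq> U} |C U.
      compactin X C \<and> openin X U}"
      by (simp add: compact_open_topology_def)
  qed
qed

text \<open>Currying: by the tube lemma a jointly continuous family of homeomorphisms is a continuous
  family for the compact-open topology.\<close>

lemma continuous_map_curry_homeo:
  assumes F: "\<And>t. t \<in> topspace T \<Longrightarrow> F t \<in> carrier (Homeo X)"
    and cont: "continuous_map (prod_topology T X) X (\<lambda>(t, x). F t x)"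
  shows "continuous_map T (homeo_topology X) F"
proof (rule continuous_map_into_homeo_topology[OF F])
  fix C U assume C: "compactin X C" and U: "openin X U"
  define W where "W = {p \<in> topspace (prod_topology T X). (\<lambda>(t, x). F t x) p \<in> U}"
  have W: "openin (prod_topology T X) W"
    unfolding W_def using cont U by (rule openin_continuous_map_preimage)
  show "openin T {t \<in> topspace T. F t ` C \<subseteq> U}"
  proof (subst openin_subopen, intro ballI)
    fix t assume t: "t \<in> {t \<in> topspace T. F t ` C \<subseteq> U}"
    have "{t} \<times> C \<subseteq> W"
      using t compactin_subset_topspace[OF C] by (auto simp: W_def)
    moreover have "t \<in> topspace T" using t by simp
    ultimately obtain A B where AB: "openin T A" "t \<in> A" "C \<subseteq> B" "A \<times> B \<subseteq> W"
      using tube_lemma_right[OF W C] by metis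
    then have "F s x \<in> U" if "s \<in> A" "x \<in> C" for s x
      using subsetD[OF AB(4), of "(s, x)"] subsetD[OF AB(3)] that by (simp add: W_def)
    then have "A \<subseteq> {t \<in> topspace T. F t ` C \<subseteq> U}"
      using openin_subset[OF AB(1)] by blast
    then show "\<exists>A. openin T A \<and> t \<in> A \<and> A \<subseteq> {t \<in> topspace T. F t ` C \<subseteq> U}"
      using AB by blast
  qed
qed

text \<open>If \<open>f (g C)\<close> lies in \<open>U\<close> and \<open>K\<close> is a compact neighbourhood of \<open>g C\<close> that \<open>f\<close> still maps
  into \<open>U\<close>, then the same inclusion holds for all \<open>f'\<close> that map \<open>K\<close> into \<open>U\<close> and all \<open>g'\<close> that map
  \<open>C\<close> into the interior of \<open>K\<close>.\<close>

lemma continuous_map_mult_Homeo: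
  assumes X: "compact_space X" "Hausdorff_space X"
  shows "continuous_map (prod_topology (homeo_topology X) (homeo_topology X)) (homeo_topology X)
    (\<lambda>(f, g). f \<otimes>\<^bsub>Homeo X\<^esub> g)"
proof (rule continuous_map_into_homeo_topology)
  interpret group "Homeo X" by (rule group_Homeo)
  show "(\<lambda>(f, g). f \<otimes>\<^bsub>Homeo X\<^esub> g) p \<in> carrier (Homeo X)"
    if "p \<in> topspace (prod_topology (homeo_topology X) (homeo_topology X))" for p
    using that by (auto simp: topspace_homeo_topology)
  fix C U assume C: "compactin X C" and U: "openin X U"
  show "openin (prod_topology (homeo_topology X) (homeo_topology X))
    {p \<in> topspace (prod_topology (homeo_topology X) (homeo_topology X)).
       (case p of (f, g) \<Rightarrow> f \<otimes>\<^bsub>Homeo X\<^esub> g) ` C \<subseteq> U}" (is "openin _ ?S")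
    unfolding openin_prod_topology_alt
  proof (intro allI impI)
    fix f g assume "(f, g) \<in> ?S"
    then have f: "f \<in> carrier (Homeo X)" and g: "g \<in> carrier (Homeo X)"
      and fg: "(f \<otimes>\<^bsub>Homeo X\<^esub> g) ` C \<subseteq> U"
      by (auto simp: topspace_homeo_topology)
    have CX: "C \<subseteq> topspace X" by (rule compactin_subset_topspace[OF C])
    have gC: "compactin X (g ` C)"
      using C Homeo_imp_continuous_map[OF g] by (rule image_compactin)
    define D where "D = topspace X - {x \<in> topspace X. f x \<in> U}"
    have D: "closedin X D"
      unfolding D_def
      using openin_continuous_map_preimage[OF Homeo_imp_continuous_map[OF f] U] by blast
    have "disjnt (g ` C) D"
      using fg CX Homeo_closed[OF g]
      by (fastforce simp: D_def disjnt_iff mult_Homeo[OF f g] compose_def)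
    \<comment> \<open>The complement of \<open>B\<close> below is the compact neighbourhood of \<open>g C\<close>.\<close>
    then obtain A B where AB: "openin X A" "openin X B" "g ` C \<subseteq> A" "D \<subseteq> B" "disjnt A B"
      using regular_space_compact_closed_separation[OF compact_Hausdorff_imp_regular_space[OF X] gC D]
      by blast
    have K: "compactin X (topspace X - B)"
      using X(1) closedin_topspace AB(2) by (intro closedin_compact_space closedin_diff)
    have 1: "f \<in> {h \<in> carrier (Homeo X). h ` (topspace X - B) \<subseteq> U}"
      using f AB by (auto simp: D_def)
    have 2: "g \<in> {h \<in> carrier (Homeo X). h ` C \<subseteq> A}"
      using g AB by auto
    have 3: "{h \<in> carrier (Homeo X). h ` (topspace X - B) \<subseteq> U} \<times> {h \<in> carrier (Homeo X). h ` C \<subseteq> A} \<subseteq> ?S"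
    proof
      fix p assume "p \<in> {h \<in> carrier (Homeo X). h ` (topspace X - B) \<subseteq> U} \<times>
        {h \<in> carrier (Homeo X). h ` C \<subseteq> A}"
      then obtain f' g' where p: "p = (f', g')"
        and f': "f' \<in> carrier (Homeo X)" "f' ` (topspace X - B) \<subseteq> U"
        and g': "g' \<in> carrier (Homeo X)" "g' ` C \<subseteq> A" by blast
      have "f' (g' x) \<in> U" if "x \<in> C" for x
      proof -
        have "g' x \<in> A" "g' x \<in> topspace X"
          using that g' openin_subset[OF AB(1)] by (auto simp: image_subset_iff)
        moreover from this have "g' x \<notin> B" using AB(5) by (simp add: disjnt_iff)
        ultimately show ?thesis using f'(2) by (simp add: image_subset_iff)
      qed
      then show "p \<in> ?S"
        using f' g' CX unfolding p by (auto simp: topspace_homeo_topology mult_Homeo compose_def subset_iff)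
    qed
    show "\<exists>P Q. openin (homeo_topology X) P \<and> openin (homeo_topology X) Q \<and> f \<in> P \<and> g \<in> Q \<and> P \<times> Q \<subseteq> ?S"
      using openin_homeo_topology[OF K U] openin_homeo_topology[OF C AB(1)] 1 2 3 by blast
  qed
qed

text \<open>A homeomorphism \<open>f\<close> satisfies \<open>f\<^sup>-\<^sup>1 C \<subseteq> U\<close> if and only if it maps the complement of \<open>U\<close> into
  the complement of \<open>C\<close>, and in a compact Hausdorff space complementation exchanges compact and
  open sets.\<close>

lemma continuous_map_inv_Homeo:
  assumes X: "compact_space X" "Hausdorff_space X"
  shows "continuous_map (homeo_topology X) (homeo_topology X) (\<lambda>f. inv\<^bsub>Homeo X\<^esub> f)"
proof (rule continuous_map_into_homeo_topology)
  interpret group "Homeo X" by (rule group_Homeo)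
  show "inv\<^bsub>Homeo X\<^esub> f \<in> carrier (Homeo X)" if "f \<in> topspace (homeo_topology X)" for f
    using that by (simp add: topspace_homeo_topology)
  fix C U assume C: "compactin X C" and U: "openin X U"
  have CX: "C \<subseteq> topspace X" by (rule compactin_subset_topspace[OF C])
  have "compactin X (topspace X - U)"
    using X(1) closedin_topspace U by (intro closedin_compact_space closedin_diff)
  moreover have "openin X (topspace X - C)"
    using compactin_imp_closedin[OF X(2) C] by blast
  moreover have "(inv\<^bsub>Homeo X\<^esub> f) ` C \<subseteq> U \<longleftrightarrow> f ` (topspace X - U) \<subseteq> topspace X - C"
    if f: "f \<in> carrier (Homeo X)" for f
  proof safe
    fix x assume *: "(inv\<^bsub>Homeo X\<^esub> f) ` C \<subseteq> U" "x \<in> topspace X" "x \<notin> U"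
    show "f x \<in> topspace X" using *(2) by (rule Homeo_closed[OF f])
    assume "f x \<in> C"
    then have "(inv\<^bsub>Homeo X\<^esub> f) (f x) \<in> U" by (rule subsetD[OF *(1) imageI])
    then show False using * inv_Homeo_cancel[OF f] by simp
  next
    fix x assume *: "f ` (topspace X - U) \<subseteq> topspace X - C" "x \<in> C"
    then have x: "x \<in> topspace X" using CX by blast
    have "(inv\<^bsub>Homeo X\<^esub> f) x \<in> topspace X" by (rule Homeo_closed[OF inv_closed[OF f] x])
    then show "(inv\<^bsub>Homeo X\<^esub> f) x \<in> U"
      using * inv_Homeo_cancel(2)[OF f x] by force
  qed
  then have "{f \<in> topspace (homeo_topology X). (inv\<^bsub>Homeo X\<^esub> f) ` C \<subseteq> U} =
      {f \<in> carrier (Homeo X). f ` (topspace X - U) \<subseteq> topspace X - C}"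
    unfolding topspace_homeo_topology by metis
  ultimately show "openin (homeo_topology X) {f \<in> topspace (homeo_topology X). (inv\<^bsub>Homeo X\<^esub> f) ` C \<subseteq> U}"
    by (simp only: openin_homeo_topology)
qed

lemma topological_group_Homeo:
  assumes "compact_space X" "Hausdorff_space X"
  shows "topological_group (Homeo X) (homeo_topology X)"
  unfolding topological_group_def
  using group_Homeo topspace_homeo_topology continuous_map_mult_Homeo continuous_map_inv_Homeo assms
  by blast

lemma topological_group_subgroup_generated:
  assumes "topological_group G T"
  shows "topological_group (subgroup_generated G S) (subtopology T (carrier (subgroup_generated G S)))"
proof -
  interpret group G using assms by (simp add: topological_group_def)
  have top: "topspace T = carrier G"
    and mult: "continuous_map (prod_topology T T) T (\<lambda>(g, h). g \<otimes>\<^bsub>G\<^esub> h)"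
    and inv: "continuous_map T T (\<lambda>g. inv\<^bsub>G\<^esub> g)"
    using assms by (auto simp: topological_group_def)
  let ?H = "subgroup_generated G S"
  interpret H: group ?H by simp
  have sub: "carrier ?H \<subseteq> carrier G" by (rule carrier_subgroup_generated_subset)
  have "continuous_map (prod_topology (subtopology T (carrier ?H)) (subtopology T (carrier ?H))) T
      (\<lambda>(g, h). g \<otimes>\<^bsub>G\<^esub> h)"
    unfolding subtopology_Times[symmetric] using mult by (rule continuous_map_from_subtopology)
  moreover have "g \<otimes>\<^bsub>G\<^esub> h \<in> carrier ?H" if "g \<in> carrier ?H" "h \<in> carrier ?H" for g h
    using H.m_closed[OF that] by simp
  moreover have "continuous_map (subtopology T (carrier ?H)) T (\<lambda>g. inv\<^bsub>G\<^esub> g)"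
    using inv by (rule continuous_map_from_subtopology)
  then have "continuous_map (subtopology T (carrier ?H)) T (\<lambda>g. inv\<^bsub>?H\<^esub> g)"
    by (rule continuous_map_eq) (use sub in auto)
  moreover have "(\<lambda>g. inv\<^bsub>?H\<^esub> g) \<in> carrier ?H \<rightarrow> carrier ?H"
    using H.inv_closed by blast
  ultimately show ?thesis
    using top sub
    by (auto simp: topological_group_def continuous_map_in_subtopology)
qed

section \<open>Flows and their factors\<close>

lemma flow_homeomorphic_map:
  assumes "flow G T X a" and "g \<in> carrier G"
  shows "homeomorphic_map X X (a g)"
proof -
  have "restrict (a g) (topspace X) \<in> carrier (Homeo X)"
    using assms by (auto simp: flow_def hom_def)
  then have "homeomorphic_map X X (restrict (a g) (topspace X))"
    by (rule Homeo_imp_homeomorphic_map)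
  then show ?thesis by (rule homeomorphic_map_eq) simp
qed

lemma flow_closed:
  assumes "flow G T X a" and "g \<in> carrier G" and "x \<in> topspace X"
  shows "a g x \<in> topspace X"
  using flow_homeomorphic_map[OF assms(1,2)] assms(3)
  by (metis homeomorphic_imp_surjective_map image_eqI)

lemma flow_mult:
  assumes "flow G T X a" and "g \<in> carrier G" and "h \<in> carrier G" and "x \<in> topspace X"
  shows "a (g \<otimes>\<^bsub>G\<^esub> h) x = a g (a h x)"
proof -
  have hom: "(\<lambda>g. restrict (a g) (topspace X)) \<in> hom G (Homeo X)"
    using assms(1) by (simp add: flow_def)
  have "restrict (a (g \<otimes>\<^bsub>G\<^esub> h)) (topspace X) =
      restrict (a g) (topspace X) \<otimes>\<^bsub>Homeo X\<^esub> restrict (a h) (topspace X)"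
    using hom_mult[OF hom assms(2,3)] .
  also have "\<dots> = compose (topspace X) (restrict (a g) (topspace X)) (restrict (a h) (topspace X))"
    using hom_in_carrier[OF hom] assms(2,3) by (intro mult_Homeo)
  finally have "restrict (a (g \<otimes>\<^bsub>G\<^esub> h)) (topspace X) x =
      compose (topspace X) (restrict (a g) (topspace X)) (restrict (a h) (topspace X)) x" by simp
  then show ?thesis
    using assms(4) flow_closed[OF assms(1,3,4)] by (simp add: compose_eq)
qed

text \<open>The identity of the group acts as an injective idempotent.\<close>

lemma flow_one:
  assumes "flow G T X a" and "x \<in> topspace X"
  shows "a \<one>\<^bsub>G\<^esub> x = x"
proof -
  interpret group G using assms(1) by (simp add: flow_def topological_group_def)
  have "a \<one>\<^bsub>G\<^esub> (a \<one>\<^bsub>G\<^esub> x) = a \<one>\<^bsub>G\<^esub> x"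
    using flow_mult[OF assms(1) one_closed one_closed assms(2)] by simp
  moreover have "inj_on (a \<one>\<^bsub>G\<^esub>) (topspace X)"
    using flow_homeomorphic_map[OF assms(1) one_closed] homeomorphic_imp_injective_map by blast
  ultimately show ?thesis
    using flow_closed[OF assms(1) one_closed assms(2)] assms(2) by (meson inj_onD)
qed

lemma flow_subgroup_of_Homeo:
  fixes S :: "('a \<Rightarrow> 'a) set"
  assumes "compact_space X" and "Hausdorff_space X"
  defines "G \<equiv> subgroup_generated (Homeo X) S"
  shows "flow G (subtopology (homeo_topology X) (carrier G)) X (\<lambda>g. g)"
proof -
  interpret group "Homeo X" by (rule group_Homeo)
  have sub: "carrier G \<subseteq> carrier (Homeo X)"
    unfolding G_def by (rule carrier_subgroup_generated_subset)
  then have [simp]: "restrict g (topspace X) = g" if "g \<in> carrier G" for g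
    using that Homeo_imp_extensional extensional_restrict by blast
  interpret G: group G unfolding G_def by simp
  have "(\<lambda>g. restrict g (topspace X)) \<in> hom G (Homeo X)"
  proof (rule homI)
    fix g h assume "g \<in> carrier G" "h \<in> carrier G"
    moreover from this have "g \<otimes>\<^bsub>G\<^esub> h \<in> carrier G" by simp
    ultimately show "restrict (g \<otimes>\<^bsub>G\<^esub> h) (topspace X) =
        restrict g (topspace X) \<otimes>\<^bsub>Homeo X\<^esub> restrict h (topspace X)"
      by (simp add: G_def)
  qed (use sub in auto)
  moreover have "continuous_map (subtopology (homeo_topology X) (carrier G)) (homeo_topology X)
      (\<lambda>g. restrict g (topspace X))"
    by (rule continuous_map_eq[OF continuous_map_from_subtopology[OF continuous_map_id]]) simp
  ultimately show ?thesis
    using assms topological_group_subgroup_generated[OF topological_group_Homeo[OF assms(1,2)]]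
    by (simp add: flow_def)
qed

text \<open>The sets \<open>{g. g C \<subseteq> U}\<close> that generate the topology of the homeomorphism group of the factor
  pull back to sets of the same kind for the total space: the preimage of a compact set \<open>C\<close> is
  closed, hence compact. Isomorphic copies of flows are the special case of an injective \<open>q\<close>.\<close>

lemma flow_factor:
  assumes X: "flow G T X a" and q: "continuous_map X Z q" "q ` topspace X = topspace Z"
    and Z: "Hausdorff_space Z"
    and equiv: "\<And>g x. g \<in> carrier G \<Longrightarrow> x \<in> topspace X \<Longrightarrow> q (a g x) = b g (q x)"
  shows "flow G T Z b"
proof -
  have tg: "topological_group G T" and comp: "compact_space X"
    using X by (simp_all add: flow_def)
  interpret group G using tg by (simp add: topological_group_def)
  have TG: "topspace T = carrier G" using tg by (simp add: topological_group_def)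
  have ZE: "\<exists>x\<in>topspace X. z = q x" if "z \<in> topspace Z" for z
    using that q(2) by (metis imageE)
  have closed: "b g z \<in> topspace Z" if "g \<in> carrier G" "z \<in> topspace Z" for g z
    using ZE[OF that(2)] equiv[OF that(1)] flow_closed[OF X that(1)] q(2) by (metis image_eqI)
  have mult: "b (g \<otimes>\<^bsub>G\<^esub> h) z = b g (b h z)" if "g \<in> carrier G" "h \<in> carrier G" "z \<in> topspace Z" for g h z
    using ZE[OF that(3)] equiv that flow_mult[OF X] flow_closed[OF X] by (metis m_closed)
  have one: "b \<one>\<^bsub>G\<^esub> z = z" if "z \<in> topspace Z" for z
    using ZE[OF that] equiv flow_one[OF X] by (metis one_closed)
  have quot: "quotient_map X Z q"
    using continuous_imp_quotient_map[OF q(1) comp Z q(2)] .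
  have cont: "continuous_map Z Z (b g)" if g: "g \<in> carrier G" for g
  proof (rule continuous_compose_quotient_map[OF quot])
    have "continuous_map X Z (q \<circ> a g)"
      using homeomorphic_imp_continuous_map[OF flow_homeomorphic_map[OF X g]] q(1)
      by (rule continuous_map_compose)
    then show "continuous_map X Z (b g \<circ> q)"
      by (rule continuous_map_eq) (simp add: equiv[OF g])
  qed
  have homeo: "restrict (b g) (topspace Z) \<in> carrier (Homeo Z)" if g: "g \<in> carrier G" for g
  proof (rule homeomorphic_map_restrict)
    have "homeomorphic_maps Z Z (b g) (b (inv\<^bsub>G\<^esub> g))"
      unfolding homeomorphic_maps_def
      using g cont[OF g] cont[of "inv\<^bsub>G\<^esub> g"] one by (simp flip: mult)
    then show "homeomorphic_map Z Z (b g)"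
      using homeomorphic_maps_map by blast
  qed
  have "(\<lambda>g. restrict (b g) (topspace Z)) \<in> hom G (Homeo Z)"
  proof (rule homI)
    fix g h assume gh: "g \<in> carrier G" "h \<in> carrier G"
    show "restrict (b (g \<otimes>\<^bsub>G\<^esub> h)) (topspace Z) =
        restrict (b g) (topspace Z) \<otimes>\<^bsub>Homeo Z\<^esub> restrict (b h) (topspace Z)"
      using gh closed mult by (auto simp: mult_Homeo homeo compose_def)
  qed (rule homeo)
  moreover have "continuous_map T (homeo_topology Z) (\<lambda>g. restrict (b g) (topspace Z))"
  proof (rule continuous_map_into_homeo_topology)
    fix C U assume C: "compactin Z C" and U: "openin Z U"
    define C' where "C' = {x \<in> topspace X. q x \<in> C}"
    define U' where "U' = {x \<in> topspace X. q x \<in> U}"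
    have "closedin X C'"
      unfolding C'_def using q(1) compactin_imp_closedin[OF Z C]
      by (rule closedin_continuous_map_preimage)
    then have C': "compactin X C'" by (rule closedin_compact_space[OF comp])
    have U': "openin X U'"
      unfolding U'_def using q(1) U by (rule openin_continuous_map_preimage)
    have CZ: "C \<subseteq> topspace Z" by (rule compactin_subset_topspace[OF C])
    have eq: "restrict (b g) (topspace Z) ` C \<subseteq> U \<longleftrightarrow> restrict (a g) (topspace X) ` C' \<subseteq> U'"
      if g: "g \<in> carrier G" for g
    proof -
      have "restrict (b g) (topspace Z) ` C \<subseteq> U \<longleftrightarrow> (\<forall>x\<in>C'. b g (q x) \<in> U)"
      proof
        assume L: "\<forall>x\<in>C'. b g (q x) \<in> U"
        show "restrict (b g) (topspace Z) ` C \<subseteq> U"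
        proof (rule image_subsetI)
          fix z assume z: "z \<in> C"
          then obtain x where "x \<in> topspace X" "z = q x" using CZ ZE by (meson subsetD)
          then show "restrict (b g) (topspace Z) z \<in> U"
            using L z CZ by (auto simp: C'_def)
        qed
      qed (use CZ in \<open>auto simp: C'_def image_subset_iff\<close>)
      also have "\<dots> \<longleftrightarrow> restrict (a g) (topspace X) ` C' \<subseteq> U'"
        using equiv[OF g] flow_closed[OF X g] by (auto simp: C'_def U'_def image_subset_iff)
      finally show ?thesis .
    qed
    have "continuous_map T (homeo_topology X) (\<lambda>g. restrict (a g) (topspace X))"
      using X by (simp add: flow_def)
    then have op: "openin T {g \<in> topspace T. restrict (a g) (topspace X) \<in>
        {f \<in> carrier (Homeo X). f ` C' \<subseteq> U'}}"
      using openin_homeo_topology[OF C' U'] by (rule openin_continuous_map_preimage)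
    have "restrict (a g) (topspace X) \<in> carrier (Homeo X)" if "g \<in> carrier G" for g
      using X that by (auto simp: flow_def hom_def)
    then have "{g \<in> topspace T. restrict (a g) (topspace X) \<in> {f \<in> carrier (Homeo X). f ` C' \<subseteq> U'}} =
        {g \<in> topspace T. restrict (b g) (topspace Z) ` C \<subseteq> U}"
      using eq by (intro Collect_cong) (metis (no_types, lifting) TG mem_Collect_eq)
    with op show "openin T {g \<in> topspace T. restrict (b g) (topspace Z) ` C \<subseteq> U}"
      by (simp only:)
  qed (simp add: homeo TG)
  moreover have "compact_space Z"
    using image_compactin[OF _ q(1), of "topspace X"] comp q(2) by (simp add: compact_space_def)
  ultimately show ?thesis
    using tg Z by (simp add: flow_def)
qed

lemma minimal_flow_factor:
  assumes X: "minimal_flow G T X a" and q: "continuous_map X Z q" "q ` topspace X = topspace Z"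
    and Z: "Hausdorff_space Z"
    and equiv: "\<And>g x. g \<in> carrier G \<Longrightarrow> x \<in> topspace X \<Longrightarrow> q (a g x) = b g (q x)"
  shows "minimal_flow G T Z b"
proof -
  have fX: "flow G T X a" using X by (simp add: minimal_flow_def)
  have "Z closure_of {b g z | g. g \<in> carrier G} = topspace Z" if z: "z \<in> topspace Z" for z
  proof
    obtain x where x: "x \<in> topspace X" "z = q x" using z q(2) by (metis imageE)
    have "topspace Z = q ` (X closure_of {a g x | g. g \<in> carrier G})"
      using X x q(2) by (simp add: minimal_flow_def)
    also have "\<dots> \<subseteq> Z closure_of (q ` {a g x | g. g \<in> carrier G})"
      using q(1) by (rule continuous_map_image_closure_subset)
    also have "q ` {a g x | g. g \<in> carrier G} = {b g z | g. g \<in> carrier G}"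
    proof -
      have "q (a g x) = b g z" if "g \<in> carrier G" for g
        using equiv[OF that] x by simp
      then show ?thesis by (simp add: image_Collect) metis
    qed
    finally show "topspace Z \<subseteq> Z closure_of {b g z | g. g \<in> carrier G}" .
  qed (rule closure_of_subset_topspace)
  moreover have "flow G T Z b"
    using fX q Z by (rule flow_factor) (simp add: equiv)
  ultimately show ?thesis
    using X q(2) by (auto simp: minimal_flow_def)
qed

text \<open>The required filter is the coarsest one along which both orbit maps converge to \<open>z\<close>; that it
  is proper says that every neighbourhood of \<open>z\<close> is reached by both points at once.\<close>

lemma proximal_pointsI:
  assumes z: "z \<in> topspace X"
    and near: "\<And>V. openin X V \<Longrightarrow> z \<in> V \<Longrightarrow> \<exists>g \<in> carrier G. a g x \<in> V \<and> a g y \<in> V"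
  shows "proximal_points G X a x y"
proof -
  define F where "F = inf (principal (carrier G))
    (inf (filtercomap (\<lambda>g. a g x) (nhdsin X z)) (filtercomap (\<lambda>g. a g y) (nhdsin X z)))"
  have "F \<noteq> bot"
  proof
    assume "F = bot"
    then have "eventually (\<lambda>_. False) (inf (inf (filtercomap (\<lambda>g. a g x) (nhdsin X z))
        (filtercomap (\<lambda>g. a g y) (nhdsin X z))) (principal (carrier G)))"
      by (simp add: F_def inf_commute)
    then obtain P Q where P: "eventually P (filtercomap (\<lambda>g. a g x) (nhdsin X z))"
      and Q: "eventually Q (filtercomap (\<lambda>g. a g y) (nhdsin X z))"
      and PQ: "\<And>g. g \<in> carrier G \<Longrightarrow> P g \<Longrightarrow> Q g \<Longrightarrow> False"
      unfolding eventually_inf_principal eventually_inf[of "\<lambda>g. g \<in> carrier G \<longrightarrow> False"] by metis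
    obtain V W where V: "openin X V" "z \<in> V" "\<And>g. a g x \<in> V \<Longrightarrow> P g"
      and W: "openin X W" "z \<in> W" "\<And>g. a g y \<in> W \<Longrightarrow> Q g"
      using P Q z unfolding eventually_filtercomap eventually_nhdsin by metis
    obtain g where "g \<in> carrier G" "a g x \<in> V \<inter> W" "a g y \<in> V \<inter> W"
      using near[of "V \<inter> W"] V W by blast
    then show False using PQ V W by blast
  qed
  moreover have "eventually (\<lambda>g. g \<in> carrier G) F"
    by (simp add: F_def eventually_inf_principal inf_commute[of "principal _"])
  moreover have "eventually (\<lambda>g. a g x \<in> V) F" "eventually (\<lambda>g. a g y \<in> V) F"
    if "openin X V" "z \<in> V" for V
  proof -
    have *: "eventually (\<lambda>u. u \<in> V) (nhdsin X z)"
      using that by (auto simp: eventually_nhdsin)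
    have "F \<le> filtercomap (\<lambda>g. a g x) (nhdsin X z)" "F \<le> filtercomap (\<lambda>g. a g y) (nhdsin X z)"
      by (simp_all add: F_def le_infI2)
    then show "eventually (\<lambda>g. a g x \<in> V) F" "eventually (\<lambda>g. a g y \<in> V) F"
      using eventually_filtercomapI[OF *] filter_leD by blast+
  qed
  ultimately show ?thesis
    unfolding proximal_points_def limitin_def
    by (intro exI[of _ F] exI[of _ z]) (simp add: z)
qed

lemma proximal_points_refl:
  assumes "flow G T X a" and "x \<in> topspace X"
  shows "proximal_points G X a x x"
proof (rule proximal_pointsI[OF assms(2)])
  fix V assume "x \<in> V"
  moreover have "\<one>\<^bsub>G\<^esub> \<in> carrier G"
    using assms(1) by (meson flow_def topological_group_def group.is_monoid monoid.one_closed)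
  ultimately show "\<exists>g\<in>carrier G. a g x \<in> V \<and> a g x \<in> V"
    using flow_one[OF assms] by metis
qed

section \<open>Towers of height two\<close>

text \<open>The order of the indices is the one that the tower dictates, so that any three elements of the
  type serve. A finite well-order has no limit index, which leaves no inverse limit to form.\<close>

lemma strictly_PI_two_steps:
  fixes W0 W1 W2 :: "'w topology" and i0 i1 i2 :: 'w
  assumes dist: "i0 \<noteq> i1" "i0 \<noteq> i2" "i1 \<noteq> i2"
    and W0: "minimal_flow G T W0 a0" "topspace W0 = {pt}"
    and W1: "minimal_flow G T W1 a1" and W2: "minimal_flow G T W2 a2"
    and p1: "proximal_extension G W1 a1 W0 a0 p1"
    and p2: "equicontinuous_extension G W2 a2 W1 a1 p2"
  shows "strictly_PI G T W2 a2"
proof -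
  define r where "r = {(i0, i0), (i1, i1), (i2, i2), (i0, i1), (i0, i2), (i1, i2)}"
  define W where "W = (\<lambda>_. W2)(i0 := W0, i1 := W1)"
  define a where "a = (\<lambda>_. a2)(i0 := a0, i1 := a1)"
  define p where "p = (\<lambda>j i x. if i = j then x else if i = i1 then p2 x
    else if j = i1 then p1 x else p1 (p2 x))"
  have field: "Field r = {i0, i1, i2}"
    by (auto simp: r_def Field_def)
  have W_simps [simp]: "W i0 = W0" "W i1 = W1" "W i2 = W2"
    and a_simps [simp]: "a i0 = a0" "a i1 = a1" "a i2 = a2"
    using dist by (auto simp: W_def a_def)
  have p_simps [simp]: "p i0 i0 = (\<lambda>x. x)" "p i1 i1 = (\<lambda>x. x)" "p i2 i2 = (\<lambda>x. x)"
    "p i1 i0 = p1" "p i2 i1 = p2" "p i2 i0 = (\<lambda>x. p1 (p2 x))"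
    using dist by (auto simp: p_def)
  have r_cases: "(i, j) \<in> r \<longleftrightarrow> i = i0 \<and> j = i0 \<or> i = i1 \<and> j = i1 \<or> i = i2 \<and> j = i2 \<or>
      i = i0 \<and> j = i1 \<or> i = i0 \<and> j = i2 \<or> i = i1 \<and> j = i2" for i j
    by (auto simp: r_def)
  have "Well_order r"
  proof -
    have "Linear_order r"
      using dist unfolding order_on_defs field
      by (auto simp: r_def refl_on_def trans_def antisym_def total_on_def)
    moreover have "finite r" by (simp add: r_def)
    then have "wf (r - Id)"
      using dist by (intro finite_acyclic_wf) (auto simp: r_def acyclic_def intro!: exI elim: tranclE)
    ultimately show ?thesis by (simp add: well_order_on_def)
  qed
  have under: "under r i0 = {i0}" "under r i1 = {i0, i1}" "under r i2 = {i0, i1, i2}"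
    and underS: "underS r i0 = {}" "underS r i1 = {i0}" "underS r i2 = {i0, i1}"
    using dist by (auto simp: under_def underS_def r_cases)
  have h1: "flow_hom G W1 a1 W0 a0 p1" and h2: "flow_hom G W2 a2 W1 a1 p2"
    using p1 p2 by (simp_all add: proximal_extension_def equicontinuous_extension_def)
  have h: "flow_hom G (W j) (a j) (W i) (a i) (p j i)" if "(i, j) \<in> r" for i j
  proof -
    have "flow_hom G X b X b (\<lambda>x. x)" for X :: "'w topology" and b
      by (simp add: flow_hom_def)
    moreover have "flow_hom G W2 a2 W0 a0 (\<lambda>x. p1 (p2 x))"
      unfolding flow_hom_def
    proof (intro conjI ballI)
      show "continuous_map W2 W0 (\<lambda>x. p1 (p2 x))"
        using h1 h2 continuous_map_compose[of W2 W1 p2 W0 p1] by (simp add: flow_hom_def o_def)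
      fix g x assume g: "g \<in> carrier G" and x: "x \<in> topspace W2"
      then have "p2 x \<in> topspace W1"
        using h2 by (auto simp: flow_hom_def continuous_map_def)
      then show "p1 (p2 (a2 g x)) = a0 g (p1 (p2 x))"
        using g x h1 h2 by (simp add: flow_hom_def)
    qed
    ultimately show ?thesis
      using that h1 h2 unfolding r_cases by auto
  qed
  have "PI_tower G T r i2 W a p"
    unfolding PI_tower_def
  proof (intro conjI)
    show "\<forall>i j k. (i, j) \<in> r \<longrightarrow> (j, k) \<in> r \<longrightarrow> (\<forall>x\<in>topspace (W k). p j i (p k j x) = p k i x)"
      using dist unfolding r_cases by auto
    show "\<forall>i\<in>Field r. \<forall>j\<in>Field r. underS r j = under r i \<longrightarrow>
        proximal_extension G (W j) (a j) (W i) (a i) (p j i) \<or>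
        equicontinuous_extension G (W j) (a j) (W i) (a i) (p j i)"
      using dist p1 p2 by (auto simp: field under underS)
    have "\<not> limit_index r n" for n
      using dist by (auto simp: limit_index_def field under underS)
    then show "\<forall>n. limit_index r n \<longrightarrow> homeomorphic_map (W n)
        (inverse_limit r (underS r n) W p) (\<lambda>x. \<lambda>i\<in>underS r n. p n i x)" by blast
  qed (use \<open>Well_order r\<close> W0 W1 W2 h dist in \<open>auto simp: field r_cases underS\<close>)
  then show ?thesis
    using W2 W_simps(3) a_simps(3) unfolding strictly_PI_def by blast
qed

section \<open>Copies of spaces\<close>

text \<open>Transporting the topology along an injection moves a flow to any type that is large
  enough.\<close>

lemma ex_homeomorphic_copy:
  assumes "inj_on e (topspace X)"
  obtains Z where "homeomorphic_maps X Z e (inv_into (topspace X) e)" and "topspace Z = e ` topspace X"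
proof -
  define d where "d = inv_into (topspace X) e"
  define Z where "Z = pullback_topology (e ` topspace X) d X"
  have d: "d (e x) = x" if "x \<in> topspace X" for x
    using assms that by (simp add: d_def)
  have top: "topspace Z = e ` topspace X"
    using d by (auto simp: Z_def topspace_pullback_topology)
  have "continuous_map X Z e"
    unfolding Z_def
  proof (rule continuous_map_pullback')
    show "continuous_map X X (d \<circ> e)"
      by (rule continuous_map_eq[OF continuous_map_id]) (simp add: d)
  qed auto
  moreover have "continuous_map Z X d"
    using continuous_map_pullback[OF continuous_map_id, of "e ` topspace X" d X] by (simp add: Z_def)
  ultimately have "homeomorphic_maps X Z e d"
    using d top by (auto simp: homeomorphic_maps_def)
  then show ?thesis using that top by (simp add: d_def)
qed

section \<open>Homeomorphisms of the sphere isotopic to the identity\<close>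

text \<open>The Alexander trick. For \<open>t > 0\<close> the homeomorphism is conjugated by the dilation by \<open>t\<close>,
  which gives \<open>x \<mapsto> t f (x / t)\<close>, and its displacement shrinks to zero with \<open>t\<close>. With the
  displacement written out, the convention \<open>x / 0 = 0\<close> yields the identity at \<open>t = 0\<close>.\<close>

definition Alexander :: "('a \<Rightarrow> 'a) \<Rightarrow> real \<Rightarrow> 'a \<Rightarrow> 'a::real_normed_vector" where
  "Alexander f t x = x + t *\<^sub>R (f (x /\<^sub>R t) - x /\<^sub>R t)"

lemma Alexander_0: "Alexander f 0 x = x"
  by (simp add: Alexander_def)

lemma Alexander_1: "Alexander f 1 x = f x"
  by (simp add: Alexander_def)

lemma Alexander_conj: "t \<noteq> 0 \<Longrightarrow> Alexander f t x = t *\<^sub>R f (x /\<^sub>R t)"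
  by (simp add: Alexander_def algebra_simps)

lemma Alexander_inverse:
  assumes "\<And>x. f (g x) = x"
  shows "Alexander f t (Alexander g t x) = x"
  by (cases "t = 0") (simp_all add: Alexander_0 Alexander_conj assms)

lemma Alexander_support:
  assumes "\<And>x. R < norm x \<Longrightarrow> f x = x" and "0 \<le> t" "t \<le> 1" and "R < norm x"
  shows "Alexander f t x = x"
proof (cases "t = 0")
  case False
  then have "norm x \<le> norm (x /\<^sub>R t)"
    using assms(2,3) by (simp add: field_simps mult_left_le_one_le)
  then have "f (x /\<^sub>R t) = x /\<^sub>R t" using assms(1,4) by simp
  then show ?thesis by (simp add: Alexander_def)
qed (simp add: Alexander_0)

lemma continuous_on_Alexander:
  fixes f :: "'a::euclidean_space \<Rightarrow> 'a"
  assumes f: "continuous_on UNIV f" and supp: "\<And>x. R < norm x \<Longrightarrow> f x = x"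
  shows "continuous_on UNIV (\<lambda>(t, x). Alexander f t x)"
proof -
  \<comment> \<open>The displacement \<open>?d\<close> is bounded, so that its multiple by \<open>t\<close> tends to \<open>0\<close> with \<open>t\<close>.\<close>
  let ?d = "\<lambda>y. f y - y"
  have "compact (?d ` cball 0 R)"
    by (intro compact_continuous_image continuous_intros continuous_on_subset[OF f]) auto
  then obtain B where B: "\<And>y. y \<in> cball 0 R \<Longrightarrow> norm (?d y) \<le> B"
    using compact_imp_bounded bounded_iff by (metis (no_types, lifting) image_eqI)
  have bound: "norm (?d y) \<le> max B 0" for y
    using B[of y] supp[of y] by (cases "norm y \<le> R") auto
  have iso: "isCont f y" for y
    using f by (simp add: continuous_on_eq_continuous_at)
  have "isCont (\<lambda>p. fst p *\<^sub>R ?d (snd p /\<^sub>R fst p)) (t, x)" for t x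
  proof (cases "t = 0")
    case False
    have "isCont (\<lambda>p::real \<times> 'a. snd p /\<^sub>R fst p) (t, x)"
      using False by (intro continuous_intros) auto
    then have "isCont (\<lambda>p. f (snd p /\<^sub>R fst p)) (t, x)"
      by (rule isCont_o2) (rule iso)
    then show ?thesis
      using False by (intro continuous_intros) auto
  next
    case True
    have "((\<lambda>p::real \<times> 'a. \<bar>fst p\<bar> * max B 0) \<longlongrightarrow> \<bar>fst (t, x)\<bar> * max B 0) (at (t, x))"
      by (intro tendsto_intros)
    then have "((\<lambda>p::real \<times> 'a. \<bar>fst p\<bar> * max B 0) \<longlongrightarrow> 0) (at (t, x))"
      using True by simp
    moreover have "\<forall>\<^sub>F p in at (t, x). norm (fst p *\<^sub>R ?d (snd p /\<^sub>R fst p)) \<le> \<bar>fst p\<bar> * max B 0"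
      using bound by (intro always_eventually allI) (simp add: mult_left_mono)
    ultimately have "((\<lambda>p. fst p *\<^sub>R ?d (snd p /\<^sub>R fst p)) \<longlongrightarrow> 0) (at (t, x))"
      by (rule Lim_null_comparison[rotated])
    then show ?thesis using True by (simp add: isCont_def)
  qed
  then have "continuous_on UNIV (\<lambda>p. fst p *\<^sub>R ?d (snd p /\<^sub>R fst p))"
    by (simp add: continuous_on_eq_continuous_at split_paired_all)
  then have "continuous_on UNIV (\<lambda>p. snd p + fst p *\<^sub>R ?d (snd p /\<^sub>R fst p))"
    by (rule continuous_on_add[OF continuous_on_snd[OF continuous_on_id]])
  then show ?thesis
    by (simp add: Alexander_def case_prod_unfold)
qed

text \<open>Conjugation by a chart of a punctured space, extended over the puncture as a fixed point.\<close>

definition chart_conj :: "'b \<Rightarrow> ('b \<Rightarrow> 'a) \<Rightarrow> ('a \<Rightarrow> 'b) \<Rightarrow> ('a \<Rightarrow> 'a) \<Rightarrow> 'b \<Rightarrow> 'b" where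
  "chart_conj N s s' A y = (if y = N then N else s' (A (s y)))"

text \<open>Near the puncture the extension by the puncture is the identity, because the compact ball of
  radius \<open>R\<close> in the chart corresponds to a closed set that misses the puncture.\<close>

lemma continuous_on_chart_conj:
  fixes S :: "'b::metric_space set" and A :: "real \<Rightarrow> 'a::euclidean_space \<Rightarrow> 'a"
  assumes s: "homeomorphism (S - {N}) UNIV s s'"
    and A: "continuous_on UNIV (\<lambda>(t, x). A t x)"
    and supp: "\<And>t x. t \<in> I \<Longrightarrow> R < norm x \<Longrightarrow> A t x = x"
  shows "continuous_on (I \<times> S) (\<lambda>(t, y). chart_conj N s s' (A t) y)"
proof -
  have s': "s' x \<in> S - {N}" for x
    using s by (auto simp: homeomorphism_def)
  define K where "K = s' ` cball 0 R"
  have "compact K"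
    unfolding K_def using s
    by (intro compact_continuous_image) (auto simp: homeomorphism_def elim: continuous_on_subset)
  then have "closed K" by (rule compact_imp_closed)
  have K: "y = N \<or> R < norm (s y)" if "y \<in> S - K" for y
  proof (rule ccontr)
    assume "\<not> (y = N \<or> R < norm (s y))"
    moreover from this have "s' (s y) = y" using s that by (auto simp: homeomorphism_def)
    ultimately show False using that unfolding K_def by (metis DiffD2 image_eqI mem_cball_0 not_less)
  qed
  have NK: "N \<notin> K" using s' by (auto simp: K_def)
  have cover: "I \<times> (S - {N}) \<union> I \<times> (S - K) = I \<times> S"
    using NK by auto
  have "openin (top_of_set (I \<times> S)) ((I \<times> S) \<inter> (UNIV \<times> (- {N})))"
    "openin (top_of_set (I \<times> S)) ((I \<times> S) \<inter> (UNIV \<times> (- K)))"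
    using \<open>closed K\<close> by (auto intro!: openin_open_Int open_Times)
  moreover have "(I \<times> S) \<inter> (UNIV \<times> (- {N})) = I \<times> (S - {N})" "(I \<times> S) \<inter> (UNIV \<times> (- K)) = I \<times> (S - K)"
    by auto
  ultimately have op: "openin (top_of_set (I \<times> S)) (I \<times> (S - {N}))"
    "openin (top_of_set (I \<times> S)) (I \<times> (S - K))" by simp_all
  have "continuous_on (I \<times> (S - {N})) (\<lambda>p. (fst p, s (snd p)))"
  proof (intro continuous_on_Pair)
    have "continuous_on (S - {N}) s" using s by (simp add: homeomorphism_def)
    then show "continuous_on (I \<times> (S - {N})) (\<lambda>p. s (snd p))"
      by (rule continuous_on_compose2) (auto intro: continuous_on_snd continuous_on_id)
  qed (auto intro: continuous_on_fst continuous_on_id)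
  then have "continuous_on (I \<times> (S - {N})) (\<lambda>p. A (fst p) (s (snd p)))"
    using continuous_on_compose2[OF A, of "I \<times> (S - {N})" "\<lambda>p. (fst p, s (snd p))"] by simp
  then have "continuous_on (I \<times> (S - {N})) (\<lambda>p. s' (A (fst p) (s (snd p))))"
    using s continuous_on_compose2[of UNIV s'] by (auto simp: homeomorphism_def)
  then have 1: "continuous_on (I \<times> (S - {N})) (\<lambda>(t, y). chart_conj N s s' (A t) y)"
    by (rule continuous_on_eq) (simp add: chart_conj_def case_prod_unfold mem_Times_iff)
  have "continuous_on (I \<times> (S - K)) snd"
    by (intro continuous_intros)
  then have 2: "continuous_on (I \<times> (S - K)) (\<lambda>(t, y). chart_conj N s s' (A t) y)"
  proof (rule continuous_on_eq)
    fix p assume p: "p \<in> I \<times> (S - K)"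
    have "chart_conj N s s' (A (fst p)) (snd p) = snd p"
    proof (cases "snd p = N")
      case False
      then have "A (fst p) (s (snd p)) = s (snd p)"
        using p K[of "snd p"] by (intro supp) auto
      moreover have "s' (s (snd p)) = snd p"
        using False p s by (auto simp: homeomorphism_def)
      ultimately show ?thesis by (simp add: chart_conj_def)
    qed (simp add: chart_conj_def)
    then show "snd p = (case p of (t, y) \<Rightarrow> chart_conj N s s' (A t) y)"
      by (simp add: case_prod_unfold)
  qed
  show ?thesis
    using continuous_on_Un_local_open[of "I \<times> (S - {N})" "I \<times> (S - K)"] op 1 2
    unfolding cover by blast
qed

lemma chart_conj_inverse:
  assumes s: "homeomorphism (S - {N}) UNIV s s'" and AB: "\<And>x. A (B x) = x"
    and y: "y \<in> S"
  shows "chart_conj N s s' A (chart_conj N s s' B y) = y"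
  using assms by (auto simp: chart_conj_def homeomorphism_def)

text \<open>A homeomorphism supported in a disc lies in the identity component: the Alexander isotopy is a
  path from the identity to it.\<close>

lemma chart_conj_in_Homeo0_S2:
  fixes f g :: "complex \<Rightarrow> complex"
  assumes N: "N \<in> sphere 0 1" and s: "homeomorphism (sphere 0 1 - {N}) UNIV s s'"
    and fg: "homeomorphism UNIV UNIV f g" and bdd: "bounded {x. \<not> (f x = x \<and> g x = x)}"
  shows "restrict (chart_conj N s s' f) (sphere 0 1) \<in> Homeo0_S2"
proof -
  obtain R where "\<And>x. x \<in> {x. \<not> (f x = x \<and> g x = x)} \<Longrightarrow> norm x \<le> R"
    using bdd unfolding bounded_iff by blast
  then have R: "R < norm x \<Longrightarrow> f x = x" "R < norm x \<Longrightarrow> g x = x" for x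
    by force+
  let ?S = "sphere 0 1 :: (real ^ 3) set"
  define H where "H f t = chart_conj N s s' (Alexander f t)" for f t
  have fg': "f (g x) = x" "g (f x) = x" for x
    using fg by (auto simp: homeomorphism_def)
  have cf: "continuous_on UNIV f" and cg: "continuous_on UNIV g"
    using fg by (auto simp: homeomorphism_def)
  have joint: "continuous_on ({0..1} \<times> ?S) (\<lambda>(t, y). H h t y)"
    if "continuous_on UNIV h" "\<And>x. R < norm x \<Longrightarrow> h x = x" for h
    unfolding H_def
    by (rule continuous_on_chart_conj[OF s continuous_on_Alexander[OF that] Alexander_support])
      (use that in auto)
  have into: "H h t y \<in> ?S" if "y \<in> ?S" for h t y
  proof -
    have "s' x \<in> ?S" for x using s unfolding homeomorphism_def by blast
    then show ?thesis using N by (simp add: H_def chart_conj_def)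
  qed
  have cont: "continuous_on ?S (H h t)"
    if "continuous_on UNIV h" "\<And>x. R < norm x \<Longrightarrow> h x = x" "t \<in> {0..1}" for h t
  proof -
    have "continuous_on ?S (\<lambda>y. (t, y))" by (intro continuous_intros)
    moreover have "(\<lambda>y. (t, y)) \<in> ?S \<rightarrow> {0..1} \<times> ?S" using that(3) by auto
    ultimately show ?thesis
      using continuous_on_compose2[OF joint[OF that(1,2)], of ?S "\<lambda>y. (t, y)"] by auto
  qed
  have inverse: "H f t (H g t y) = y" "H g t (H f t y) = y" if "y \<in> ?S" for t y
    unfolding H_def using fg' that by (auto intro!: chart_conj_inverse[OF s] Alexander_inverse)
  have "homeomorphic_maps S2 S2 (H f t) (H g t)" if t: "t \<in> {0..1}" for t
    using cont[OF cf R(1) t] cont[OF cg R(2) t] into inverse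
    by (simp add: homeomorphic_maps_def Pi_iff)
  then have homeo: "restrict (H f t) ?S \<in> carrier (Homeo S2)" if "t \<in> {0..1}" for t
    using homeomorphic_map_restrict[of S2 "H f t"] homeomorphic_maps_map that by fastforce
  have "continuous_on ({0..1} \<times> ?S) (\<lambda>(t, y). restrict (H f t) ?S y)"
    by (rule continuous_on_eq[OF joint[OF cf R(1)]]) auto
  then have "continuous_map (top_of_set {0..1}) (homeo_topology S2) (\<lambda>t. restrict (H f t) ?S)"
    using homeo into by (intro continuous_map_curry_homeo) auto
  then have conn: "connectedin (homeo_topology S2) ((\<lambda>t. restrict (H f t) ?S) ` {0..1})"
    by (rule connectedin_continuous_map_image) (simp add: connectedin_subtopology)
  have "restrict (H f 0) ?S = \<one>\<^bsub>Homeo S2\<^esub>"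
    using s by (auto simp: H_def chart_conj_def Alexander_0 one_Homeo homeomorphism_def)
  then have 0: "\<one>\<^bsub>Homeo S2\<^esub> \<in> (\<lambda>t. restrict (H f t) ?S) ` {0..1}"
    by (metis atLeastAtMost_iff image_eqI order_refl zero_le_one)
  have "restrict (H f 1) ?S = restrict (chart_conj N s s' f) ?S"
    by (simp add: H_def Alexander_1[abs_def])
  then have 1: "restrict (chart_conj N s s' f) ?S \<in> (\<lambda>t. restrict (H f t) ?S) ` {0..1}"
    by (metis atLeastAtMost_iff image_eqI order_refl zero_le_one)
  show ?thesis
    unfolding Homeo0_S2_def mem_Collect_eq connected_component_of_def using conn 0 1 by blast
qed

lemma ex_inj_choice:
  assumes "finite F" and "\<And>y. y \<in> F \<Longrightarrow> infinite (B y)"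
  shows "\<exists>w. inj_on w F \<and> (\<forall>y\<in>F. w y \<in> B y)"
  using assms
proof (induction F)
  case (insert a F)
  then obtain w where w: "inj_on w F" "\<forall>y\<in>F. w y \<in> B y" by auto
  have "infinite (B a - w ` F)" using insert by auto
  then obtain b where "b \<in> B a - w ` F" by (metis ex_in_conv finite.emptyI)
  with w insert(2) have "inj_on (w(a := b)) (insert a F) \<and> (\<forall>y\<in>insert a F. (w(a := b)) y \<in> B y)"
    by (auto simp: inj_on_def)
  then show ?case by blast
qed auto

text \<open>A connected space with more than one point has no isolated points.\<close>

lemma infinite_open_S2:
  assumes "openin S2 W" and "W \<noteq> {}"
  shows "infinite W"
proof -
  obtain y where y: "y \<in> W" using assms by blast
  obtain T where T: "open T" "W = sphere 0 1 \<inter> T"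
    using assms(1) by (auto simp: openin_open)
  have conn: "connected (sphere (0 :: real ^ 3) 1)"
    by (rule connected_sphere) simp
  have "sphere (0 :: real ^ 3) 1 \<noteq> {x}" for x
  proof
    assume S: "sphere (0 :: real ^ 3) 1 = {x}"
    then have "norm x = 1" by (metis mem_sphere_0 singletonI)
    then have "- x \<in> sphere 0 1" by simp
    then have "- x = x" unfolding S by simp
    then have "x = 0" by (simp add: vec_eq_iff)
    with \<open>norm x = 1\<close> show False by simp
  qed
  then have "y islimpt sphere 0 1"
    using connected_imp_perfect[OF conn] y T by blast
  then show ?thesis
    using y T by (auto simp: islimpt_eq_acc_point Int_commute)
qed

lemma punctured_S2_chart:
  fixes N :: "real ^ 3"
  assumes "N \<in> sphere 0 1"
  obtains s :: "real ^ 3 \<Rightarrow> complex" and s' where "homeomorphism (sphere 0 1 - {N}) UNIV s s'"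
proof -
  have "aff_dim (cball (0 :: real ^ 3) 1) = aff_dim (UNIV :: complex set) + 1"
    by (simp add: aff_dim_cball)
  then have "rel_frontier (cball (0 :: real ^ 3) 1) - {N} homeomorphic (UNIV :: complex set)"
    using assms by (intro homeomorphic_punctured_sphere_affine_gen) auto
  then show ?thesis using that by (auto simp: homeomorphic_def)
qed

text \<open>Puncturing the sphere at a point outside \<open>F\<close> turns the problem into one in the plane, where
  finitely many points can be moved simultaneously with bounded support.\<close>

lemma Homeo0_S2_moves_finite_sets:
  assumes F: "finite F" "F \<subseteq> sphere 0 1"
    and W: "\<And>y. y \<in> F \<Longrightarrow> openin S2 (W y)" "\<And>y. y \<in> F \<Longrightarrow> W y \<noteq> {}"
  shows "\<exists>h \<in> Homeo0_S2. \<forall>y\<in>F. h y \<in> W y"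
proof -
  have "infinite (sphere (0 :: real ^ 3) 1)"
    by (rule infinite_open_S2) auto
  then obtain N where N: "N \<in> sphere 0 1" "N \<notin> F"
    using F by (meson finite_subset subsetI)
  obtain s :: "real ^ 3 \<Rightarrow> complex" and s' where s: "homeomorphism (sphere 0 1 - {N}) UNIV s s'"
    using punctured_S2_chart[OF N(1)] .
  have "infinite (W y - {N})" if "y \<in> F" for y
    using infinite_open_S2[OF W(1)[OF that] W(2)[OF that]] by simp
  then obtain w where w: "inj_on w F" "\<And>y. y \<in> F \<Longrightarrow> w y \<in> W y - {N}"
    using ex_inj_choice[OF F(1), of "\<lambda>y. W y - {N}"] by auto
  have wS: "w y \<in> sphere 0 1 - {N}" and yS: "y \<in> sphere 0 1 - {N}" if "y \<in> F" for y
    using w(2)[OF that] W(1)[OF that] openin_subset F(2) N that by fastforce+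
  have s's: "s' (s y) = y" if "y \<in> sphere 0 1 - {N}" for y
    using s that by (auto simp: homeomorphism_def)
  have "s i \<noteq> s j" "s (w i) \<noteq> s (w j)" if "i \<in> F" "j \<in> F" "i \<noteq> j" for i j
    using s's[OF yS] s's[OF wS] that w(1) by (metis inj_onD)+
  then have pw: "pairwise (\<lambda>i j. s i \<noteq> s j \<and> s (w i) \<noteq> s (w j)) F"
    by (simp add: pairwise_def)
  obtain f g where fg: "homeomorphism UNIV UNIV f g" "\<And>y. y \<in> F \<Longrightarrow> f (s y) = s (w y)"
    and bdd: "bounded {x. \<not> (f x = x \<and> g x = x)}"
    by (rule homeomorphism_moving_points_exists[of "UNIV :: complex set" UNIV F s "\<lambda>y. s (w y)"])
      (use F pw in auto)
  have "restrict (chart_conj N s s' f) (sphere 0 1) y \<in> W y" if "y \<in> F" for y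
  proof -
    have "restrict (chart_conj N s s' f) (sphere 0 1) y = w y"
      using yS[OF that] fg(2)[OF that] s's[OF wS[OF that]] by (auto simp: chart_conj_def)
    then show ?thesis using w(2)[OF that] by simp
  qed
  then show ?thesis
    using chart_conj_in_Homeo0_S2[OF N(1) s fg(1) bdd] by blast
qed

section \<open>The group of the flow\<close>

text \<open>The lemmas on product topologies apply as long as \<open>Y\<close> keeps the form of a product.\<close>

declare prod_topology_subtopology_eu [simp del]

lemma topspace_Y: "topspace Y = sphere 0 1 \<times> sphere 0 1"
  by simp

lemma compact_space_Y: "compact_space Y" and Hausdorff_space_Y: "Hausdorff_space Y"
  by (simp_all add: compact_space_prod_topology compact_space_subtopology Hausdorff_space_prod_topology
      Hausdorff_space_subtopology)

text \<open>Skew products over the sphere. All elements of the group have this form, with a homeomorphism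
  \<open>h\<close> of the sphere and a continuous cocycle \<open>c\<close> with values in the circle, because the generators
  do and such maps form a group.\<close>

definition skew ::
  "(real ^ 3 \<Rightarrow> real ^ 3) \<Rightarrow> (real ^ 3 \<Rightarrow> complex) \<Rightarrow> (real ^ 3) \<times> complex \<Rightarrow> (real ^ 3) \<times> complex" where
  "skew h c = (\<lambda>(y, \<zeta>) \<in> topspace Y. (h y, c y * \<zeta>))"

definition cocycle :: "(real ^ 3 \<Rightarrow> complex) \<Rightarrow> bool" where
  "cocycle c \<longleftrightarrow> continuous_on (sphere 0 1) c \<and> (\<forall>y \<in> sphere 0 1. norm (c y) = 1)"

lemma skew_apply: "y \<in> sphere 0 1 \<Longrightarrow> \<zeta> \<in> sphere 0 1 \<Longrightarrow> skew h c (y, \<zeta>) = (h y, c y * \<zeta>)"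
  by (simp add: skew_def)

lemma skew_compose:
  assumes "h' \<in> carrier (Homeo S2)" and "cocycle c'"
  shows "compose (topspace Y) (skew h c) (skew h' c') = skew (compose (sphere 0 1) h h') (\<lambda>y. c (h' y) * c' y)"
proof
  fix p
  show "compose (topspace Y) (skew h c) (skew h' c') p =
      skew (compose (sphere 0 1) h h') (\<lambda>y. c (h' y) * c' y) p"
  proof (cases "p \<in> topspace Y")
    case True
    then obtain y \<zeta> where p: "p = (y, \<zeta>)" "y \<in> sphere 0 1" "\<zeta> \<in> sphere 0 1" by auto
    then have "h' y \<in> sphere 0 1" "c' y * \<zeta> \<in> sphere 0 1"
      using Homeo_closed[OF assms(1), of y] assms(2) by (auto simp: cocycle_def norm_mult)
    with p show ?thesis by (simp add: compose_def skew_def mult.assoc)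
  qed (simp add: compose_def skew_def)
qed

lemma cocycle_compose:
  assumes "h \<in> carrier (Homeo S2)" and "cocycle c"
  shows "cocycle (\<lambda>y. c (h y))"
proof -
  have h: "continuous_on (sphere 0 1) h" "h \<in> sphere 0 1 \<rightarrow> sphere 0 1"
    using Homeo_imp_continuous_map[OF assms(1)] by simp_all
  have "continuous_on (sphere 0 1) (\<lambda>y. c (h y))"
    using assms(2) h by (intro continuous_on_compose2[of "sphere 0 1" c _ h]) (auto simp: cocycle_def)
  then show ?thesis using assms(2) h(2) by (auto simp: cocycle_def Pi_iff)
qed

lemma cocycle_mult: "cocycle c \<Longrightarrow> cocycle d \<Longrightarrow> cocycle (\<lambda>y. c y * d y)"
  by (auto simp: cocycle_def norm_mult intro!: continuous_intros)

lemma cocycle_inverse: "cocycle c \<Longrightarrow> cocycle (\<lambda>y. inverse (c y))"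
  by (auto simp: cocycle_def norm_inverse intro!: continuous_on_inverse)

lemma cocycle_const: "norm k = 1 \<Longrightarrow> cocycle (\<lambda>_. k)"
  by (auto simp: cocycle_def)

lemma skew_cong:
  assumes "\<And>y. y \<in> sphere 0 1 \<Longrightarrow> h y = h' y" and "\<And>y. y \<in> sphere 0 1 \<Longrightarrow> c y = c' y"
  shows "skew h c = skew h' c'"
  using assms by (auto simp: skew_def fun_eq_iff)

lemma skew_one: "skew \<one>\<^bsub>Homeo S2\<^esub> (\<lambda>_. 1) = \<one>\<^bsub>Homeo Y\<^esub>"
  by (auto simp: skew_def one_Homeo fun_eq_iff)

lemma continuous_map_skew:
  assumes "h \<in> carrier (Homeo S2)" and "cocycle c"
  shows "continuous_map Y Y (skew h c)"
proof -
  have h: "continuous_on (sphere 0 1) h" "h \<in> sphere 0 1 \<rightarrow> sphere 0 1"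
    using Homeo_imp_continuous_map[OF assms(1)] by simp_all
  have c: "continuous_on (sphere 0 1) c" "\<And>y. y \<in> sphere 0 1 \<Longrightarrow> norm (c y) = 1"
    using assms(2) by (auto simp: cocycle_def)
  let ?D = "sphere 0 1 \<times> sphere 0 1 :: ((real ^ 3) \<times> complex) set"
  have fst: "continuous_on ?D fst" "fst \<in> ?D \<rightarrow> sphere 0 1" by (auto intro: continuous_intros)
  have "continuous_on ?D (\<lambda>p. h (fst p))"
    by (rule continuous_on_compose2[OF h(1) fst(1)]) auto
  moreover have "continuous_on ?D (\<lambda>p. c (fst p))"
    by (rule continuous_on_compose2[OF c(1) fst(1)]) auto
  ultimately have "continuous_on ?D (\<lambda>p. (h (fst p), c (fst p) * snd p))"
    by (intro continuous_intros)
  moreover have "(h y, c y * \<zeta>) \<in> ?D" if "y \<in> sphere 0 1" "\<zeta> \<in> sphere 0 1" for y \<zeta>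
    using that h(2) c(2) by (auto simp: norm_mult Pi_iff)
  then have "(\<lambda>p. (h (fst p), c (fst p) * snd p)) \<in> ?D \<rightarrow> ?D" by auto
  ultimately have "continuous_map Y Y (\<lambda>p. (h (fst p), c (fst p) * snd p))"
    by (simp add: prod_topology_subtopology_eu)
  then show ?thesis
    by (rule continuous_map_eq) (auto simp: skew_def)
qed

lemma skew_inverse:
  assumes h: "h \<in> carrier (Homeo S2)" and c: "cocycle c"
  defines "k \<equiv> inv\<^bsub>Homeo S2\<^esub> h"
  shows "compose (topspace Y) (skew k (\<lambda>y. inverse (c (k y)))) (skew h c) = \<one>\<^bsub>Homeo Y\<^esub>"
    and "compose (topspace Y) (skew h c) (skew k (\<lambda>y. inverse (c (k y)))) = \<one>\<^bsub>Homeo Y\<^esub>"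
proof -
  interpret group "Homeo S2" by (rule group_Homeo)
  have k: "k \<in> carrier (Homeo S2)" using h by (simp add: k_def)
  have hk: "h (k y) = y" "k (h y) = y" if "y \<in> sphere 0 1" for y
    using inv_Homeo_cancel[OF h, of y] that by (simp_all add: k_def)
  have ky: "k y \<in> sphere 0 1" if "y \<in> sphere 0 1" for y
    using Homeo_closed[OF k, of y] that by simp
  have nz: "c y \<noteq> 0" if "y \<in> sphere 0 1" for y
    using c that by (force simp: cocycle_def)
  show "compose (topspace Y) (skew k (\<lambda>y. inverse (c (k y)))) (skew h c) = \<one>\<^bsub>Homeo Y\<^esub>"
    unfolding skew_compose[OF h c] skew_one[symmetric]
    by (rule skew_cong) (simp_all add: hk nz compose_def one_Homeo)
  show "compose (topspace Y) (skew h c) (skew k (\<lambda>y. inverse (c (k y)))) = \<one>\<^bsub>Homeo Y\<^esub>"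
    unfolding skew_compose[OF k cocycle_inverse[OF cocycle_compose[OF k c]]] skew_one[symmetric]
    by (rule skew_cong) (use hk nz[OF ky] in \<open>simp_all add: compose_def one_Homeo\<close>)
qed

lemma skew_in_Homeo:
  assumes h: "h \<in> carrier (Homeo S2)" and c: "cocycle c"
  shows "skew h c \<in> carrier (Homeo Y)"
proof (rule HomeoI)
  interpret group "Homeo S2" by (rule group_Homeo)
  define k where "k = inv\<^bsub>Homeo S2\<^esub> h"
  have k: "k \<in> carrier (Homeo S2)" using h by (simp add: k_def)
  let ?g = "skew k (\<lambda>y. inverse (c (k y)))"
  have "?g (skew h c p) = p" "skew h c (?g p) = p" if "p \<in> topspace Y" for p
    using fun_cong[OF skew_inverse(1)[OF h c], of p] fun_cong[OF skew_inverse(2)[OF h c], of p] that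
    by (simp_all add: compose_eq one_Homeo k_def)
  then have "homeomorphic_maps Y Y (skew h c) ?g"
    unfolding homeomorphic_maps_def
    using continuous_map_skew[OF h c] continuous_map_skew[OF k cocycle_inverse[OF cocycle_compose[OF k c]]]
    by blast
  then show "homeomorphic_map Y Y (skew h c)"
    using homeomorphic_maps_map by blast
  show "skew h c \<in> extensional (topspace Y)"
    by (simp add: skew_def)
qed

lemma subgroup_skew:
  "subgroup {skew h c | h c. h \<in> carrier (Homeo S2) \<and> cocycle c} (Homeo Y)" (is "subgroup ?K _")
proof -
  interpret A: group "Homeo S2" by (rule group_Homeo)
  interpret B: group "Homeo Y" by (rule group_Homeo)
  show ?thesis
  proof (rule B.subgroupI)
    show "?K \<subseteq> carrier (Homeo Y)" using skew_in_Homeo by blast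
    show "?K \<noteq> {}" using cocycle_const[of 1] A.one_closed by auto
  next
    fix f assume "f \<in> ?K"
    then obtain h c where f: "f = skew h c" and h: "h \<in> carrier (Homeo S2)" and c: "cocycle c" by blast
    define k where "k = inv\<^bsub>Homeo S2\<^esub> h"
    have k: "k \<in> carrier (Homeo S2)" using h by (simp add: k_def)
    have c': "cocycle (\<lambda>y. inverse (c (k y)))"
      using cocycle_inverse[OF cocycle_compose[OF k c]] .
    have "skew k (\<lambda>y. inverse (c (k y))) \<otimes>\<^bsub>Homeo Y\<^esub> f = \<one>\<^bsub>Homeo Y\<^esub>"
      using skew_inverse(1)[OF h c] mult_Homeo[OF skew_in_Homeo[OF k c'] skew_in_Homeo[OF h c]]
      by (simp add: f k_def)
    then have "inv\<^bsub>Homeo Y\<^esub> f = skew k (\<lambda>y. inverse (c (k y)))"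
      using B.inv_equality skew_in_Homeo[OF h c] skew_in_Homeo[OF k c'] f by blast
    then show "inv\<^bsub>Homeo Y\<^esub> f \<in> ?K" using k c' by blast
  next
    fix f g assume "f \<in> ?K" "g \<in> ?K"
    then obtain h c h' c' where f: "f = skew h c" "h \<in> carrier (Homeo S2)" "cocycle c"
      and g: "g = skew h' c'" "h' \<in> carrier (Homeo S2)" "cocycle c'" by blast
    have "f \<otimes>\<^bsub>Homeo Y\<^esub> g = skew (compose (sphere 0 1) h h') (\<lambda>y. c (h' y) * c' y)"
      unfolding f(1) g(1) mult_Homeo[OF skew_in_Homeo[OF f(2,3)] skew_in_Homeo[OF g(2,3)]]
      by (rule skew_compose[OF g(2,3)])
    moreover have "compose (sphere 0 1) h h' \<in> carrier (Homeo S2)"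
      using A.m_closed[OF f(2) g(2)] mult_Homeo[OF f(2) g(2)] by simp
    moreover have "cocycle (\<lambda>y. c (h' y) * c' y)"
      using cocycle_mult[OF cocycle_compose[OF g(2) f(3)] g(3)] .
    ultimately show "f \<otimes>\<^bsub>Homeo Y\<^esub> g \<in> ?K" by blast
  qed
qed

lemma Homeo0_S2_subset: "Homeo0_S2 \<subseteq> carrier (Homeo S2)"
  unfolding Homeo0_S2_def
  using connected_component_of_subset_topspace topspace_homeo_topology by metis

definition GY_generators where
  "GY_generators \<phi> = {(\<lambda>(y, \<zeta>) \<in> topspace Y. (g y, \<zeta>)) | g. g \<in> Homeo0_S2} \<union>
      {Phi \<phi> t | t. t \<in> UNIV} \<union>
      {(\<lambda>(y, \<zeta>) \<in> topspace Y. (y, k * \<zeta>)) | k. k \<in> topspace S1}"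

lemma GY_eq: "GY \<phi> = subgroup_generated (Homeo Y) (GY_generators \<phi>)"
  by (simp only: GY_def GY_generators_def)

lemma lift_eq_skew: "(\<lambda>(y, \<zeta>) \<in> topspace Y. (g y, \<zeta>)) = skew g (\<lambda>_. 1)"
  by (auto simp: skew_def fun_eq_iff)

lemma rotation_eq_skew: "(\<lambda>(y, \<zeta>) \<in> topspace Y. (y, k * \<zeta>)) = skew \<one>\<^bsub>Homeo S2\<^esub> (\<lambda>_. k)"
  by (auto simp: skew_def fun_eq_iff one_Homeo)

lemma Phi_eq_skew: "Phi \<phi> t = skew \<one>\<^bsub>Homeo S2\<^esub> (\<lambda>y. exp (\<i> * of_real (pi * t * \<phi> y)))"
  by (auto simp: skew_def Phi_def fun_eq_iff one_Homeo)

context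
  fixes \<phi> :: "real ^ 3 \<Rightarrow> real"
  assumes \<phi>: "continuous_map S2 (top_of_set {0..1}) \<phi>"
begin

lemma cocycle_exp: "cocycle (\<lambda>y. exp (\<i> * of_real (pi * t * \<phi> y)))"
  unfolding cocycle_def
proof
  have "continuous_on (sphere 0 1) \<phi>" using \<phi> by simp
  then show "continuous_on (sphere 0 1) (\<lambda>y. exp (\<i> * of_real (pi * t * \<phi> y)))"
    by (intro continuous_intros)
qed simp

lemma generator_skew:
  assumes "f \<in> GY_generators \<phi>"
  shows "\<exists>h c. f = skew h c \<and> h \<in> carrier (Homeo S2) \<and> cocycle c"
proof -
  interpret group "Homeo S2" by (rule group_Homeo)
  consider (lift) g where "f = skew g (\<lambda>_. 1)" "g \<in> Homeo0_S2"
    | (fibre) t where "f = Phi \<phi> t"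
    | (rotation) k where "f = skew \<one>\<^bsub>Homeo S2\<^esub> (\<lambda>_. k)" "norm k = 1"
    using assms unfolding GY_generators_def lift_eq_skew rotation_eq_skew by auto
  then show ?thesis
  proof cases
    case lift
    then show ?thesis using Homeo0_S2_subset cocycle_const[of 1] by auto
  next
    case fibre
    then show ?thesis using cocycle_exp[of t] one_closed unfolding Phi_eq_skew by blast
  next
    case rotation
    then show ?thesis using cocycle_const[of k] one_closed by blast
  qed
qed

lemma generator_in_GY:
  assumes "f \<in> GY_generators \<phi>"
  shows "f \<in> carrier (GY \<phi>)"
proof -
  have "f \<in> carrier (Homeo Y)"
    using generator_skew[OF assms] skew_in_Homeo by blast
  then show ?thesis
    using assms unfolding GY_eq carrier_subgroup_generated by (intro generate.incl) blast
qed

lemma lift_in_GY: "g \<in> Homeo0_S2 \<Longrightarrow> skew g (\<lambda>_. 1) \<in> carrier (GY \<phi>)"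
  by (rule generator_in_GY) (unfold GY_generators_def lift_eq_skew, blast)

lemma Phi_in_GY: "Phi \<phi> t \<in> carrier (GY \<phi>)"
  by (rule generator_in_GY) (unfold GY_generators_def, blast)

lemma rotation_in_GY: "norm k = 1 \<Longrightarrow> skew \<one>\<^bsub>Homeo S2\<^esub> (\<lambda>_. k) \<in> carrier (GY \<phi>)"
  by (rule generator_in_GY) (unfold GY_generators_def rotation_eq_skew, auto)

lemma GY_skew:
  assumes "g \<in> carrier (GY \<phi>)"
  obtains h c where "g = skew h c" and "h \<in> carrier (Homeo S2)" and "cocycle c"
proof -
  interpret B: group "Homeo Y" by (rule group_Homeo)
  have "GY_generators \<phi> \<subseteq> {skew h c | h c. h \<in> carrier (Homeo S2) \<and> cocycle c}"
    using generator_skew by blast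
  then have "carrier (GY \<phi>) \<subseteq> {skew h c | h c. h \<in> carrier (Homeo S2) \<and> cocycle c}"
    unfolding GY_eq using B.subgroup_generated_minimal[OF subgroup_skew] by blast
  then show ?thesis using assms that by blast
qed

lemma GY_mult_apply:
  assumes "f \<in> carrier (GY \<phi>)" and "g \<in> carrier (GY \<phi>)"
  shows "f \<otimes>\<^bsub>GY \<phi>\<^esub> g \<in> carrier (GY \<phi>)" and "p \<in> topspace Y \<Longrightarrow> (f \<otimes>\<^bsub>GY \<phi>\<^esub> g) p = f (g p)"
proof -
  interpret B: group "Homeo Y" by (rule group_Homeo)
  interpret G: group "GY \<phi>" unfolding GY_eq by simp
  show "f \<otimes>\<^bsub>GY \<phi>\<^esub> g \<in> carrier (GY \<phi>)" using assms by simp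
  have "f \<in> carrier (Homeo Y)" "g \<in> carrier (Homeo Y)"
    using assms B.carrier_subgroup_generated_subset unfolding GY_eq by blast+
  then show "p \<in> topspace Y \<Longrightarrow> (f \<otimes>\<^bsub>GY \<phi>\<^esub> g) p = f (g p)"
    by (simp add: GY_eq mult_Homeo compose_eq)
qed

lemma fst_GY:
  assumes "g \<in> carrier (GY \<phi>)" and "y \<in> sphere 0 1" and "\<zeta> \<in> sphere 0 1" and "\<zeta>' \<in> sphere 0 1"
  shows "fst (g (y, \<zeta>)) = fst (g (y, \<zeta>'))"
  using GY_skew[OF assms(1)] assms(2-4) by (metis fst_conv skew_apply)

lemma GY_commutes_rotation:
  assumes "g \<in> carrier (GY \<phi>)" and "y \<in> sphere 0 1" and "\<zeta> \<in> sphere 0 1" and "norm k = 1"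
  shows "g (y, k * \<zeta>) = (fst (g (y, \<zeta>)), k * snd (g (y, \<zeta>)))"
proof -
  obtain h c where "g = skew h c" using GY_skew[OF assms(1)] .
  moreover have "k * \<zeta> \<in> sphere 0 1" using assms by (simp add: norm_mult)
  ultimately show ?thesis using assms by (simp add: skew_apply mult_ac)
qed

text \<open>The group acts on the fibres by rotations, which are isometries.\<close>

lemma dist_GY_fibre:
  assumes "g \<in> carrier (GY \<phi>)" and "p \<in> topspace Y" and "q \<in> topspace Y" and "fst p = fst q"
  shows "dist (g p) (g q) = dist p q"
proof -
  obtain h c where g: "g = skew h c" "cocycle c" using GY_skew[OF assms(1)] .
  obtain y \<zeta> \<zeta>' where p: "p = (y, \<zeta>)" "q = (y, \<zeta>')" "y \<in> sphere 0 1" "\<zeta> \<in> sphere 0 1" "\<zeta>' \<in> sphere 0 1"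
    using assms(2-4) by (cases p; cases q) auto
  have "norm (c y) = 1" using g p by (auto simp: cocycle_def)
  then have "dist (c y * \<zeta>) (c y * \<zeta>') = dist \<zeta> \<zeta>'"
    by (simp add: dist_norm norm_mult flip: right_diff_distrib)
  then show ?thesis using p by (simp add: g(1) skew_apply dist_Pair_Pair)
qed

text \<open>The points of \<open>F\<close> are first sorted: those in \<open>A\<close> are moved into \<open>U1\<close>, where \<open>\<Phi>\<^sub>1\<close> acts on the
  fibres by \<open>e\<^sup>i\<^sup>\<pi> = -1\<close>, and the others into \<open>U2\<close>, where it acts trivially. Afterwards all of them
  are moved into \<open>V\<close>, which does not touch the fibre coordinate.\<close>

lemma GY_collapses:
  assumes U1: "openin S2 U1" "U1 \<noteq> {}" "\<And>y. y \<in> U1 \<Longrightarrow> \<phi> y = 1"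
    and U2: "openin S2 U2" "U2 \<noteq> {}" "\<And>y. y \<in> U2 \<Longrightarrow> \<phi> y = 0"
    and F: "finite F" "F \<subseteq> sphere 0 1"
    and V: "openin S2 V" "V \<noteq> {}" and k: "norm k = 1"
  shows "\<exists>g \<in> carrier (GY \<phi>). \<forall>y\<in>F. \<exists>z\<in>V. \<forall>\<zeta>\<in>sphere 0 1.
    g (y, \<zeta>) = (z, k * (if y \<in> A then - 1 else 1) * \<zeta>)"
proof -
  let ?S = "sphere (0 :: real ^ 3) 1"
  obtain h1 where h1: "h1 \<in> Homeo0_S2" "\<And>y. y \<in> F \<Longrightarrow> h1 y \<in> (if y \<in> A then U1 else U2)"
  proof -
    have "\<exists>h \<in> Homeo0_S2. \<forall>y\<in>F. h y \<in> (if y \<in> A then U1 else U2)"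
      by (rule Homeo0_S2_moves_finite_sets[OF F]) (use U1 U2 in auto)
    then show ?thesis using that by blast
  qed
  have h1S: "h1 y \<in> ?S" if "y \<in> ?S" for y
    using Homeo_closed[of h1 S2 y] h1(1) Homeo0_S2_subset that by auto
  have "finite (h1 ` F)" "h1 ` F \<subseteq> ?S" using F h1S by auto
  then obtain h2 where h2: "h2 \<in> Homeo0_S2" "\<And>y. y \<in> h1 ` F \<Longrightarrow> h2 y \<in> V"
    using Homeo0_S2_moves_finite_sets[of "h1 ` F" "\<lambda>_. V"] V by auto
  let ?l1 = "skew h1 (\<lambda>_. 1)" and ?l2 = "skew h2 (\<lambda>_. 1)"
    and ?r = "skew \<one>\<^bsub>Homeo S2\<^esub> (\<lambda>_. k)"
  have gens: "?l1 \<in> carrier (GY \<phi>)" "?l2 \<in> carrier (GY \<phi>)" "?r \<in> carrier (GY \<phi>)"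
    "Phi \<phi> 1 \<in> carrier (GY \<phi>)"
    using h1(1) h2(1) k by (simp_all add: lift_in_GY Phi_in_GY rotation_in_GY)
  define g where "g = ?l2 \<otimes>\<^bsub>GY \<phi>\<^esub> (Phi \<phi> 1 \<otimes>\<^bsub>GY \<phi>\<^esub> (?l1 \<otimes>\<^bsub>GY \<phi>\<^esub> ?r))"
  have g: "g \<in> carrier (GY \<phi>)" using gens by (simp add: g_def GY_mult_apply)
  have "g (y, \<zeta>) = (h2 (h1 y), k * (if y \<in> A then - 1 else 1) * \<zeta>)"
    if y: "y \<in> F" and \<zeta>: "\<zeta> \<in> sphere 0 1" for y \<zeta>
  proof -
    have yS: "y \<in> ?S" using y F by blast
    have k\<zeta>: "k * \<zeta> \<in> sphere 0 1" using k \<zeta> by (simp add: norm_mult)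
    define e where "e = exp (\<i> * of_real (pi * 1 * \<phi> (h1 y)))"
    have e: "e = (if y \<in> A then - 1 else 1)"
      using h1(2)[OF y] U1(3) U2(3) by (auto simp: e_def)
    have ek\<zeta>: "e * (k * \<zeta>) \<in> sphere 0 1" using k\<zeta> e by (auto simp: norm_mult)
    have "g (y, \<zeta>) = ?l2 (Phi \<phi> 1 (?l1 (?r (y, \<zeta>))))"
      using gens yS \<zeta> by (simp add: g_def GY_mult_apply)
    also have "?r (y, \<zeta>) = (y, k * \<zeta>)" using yS \<zeta> by (simp add: skew_apply one_Homeo)
    also have "?l1 (y, k * \<zeta>) = (h1 y, k * \<zeta>)" using yS k\<zeta> by (simp add: skew_apply)
    also have "Phi \<phi> 1 (h1 y, k * \<zeta>) = (h1 y, e * (k * \<zeta>))"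
      using h1S[OF yS] k\<zeta> by (simp add: Phi_eq_skew skew_apply one_Homeo e_def)
    also have "?l2 (h1 y, e * (k * \<zeta>)) = (h2 (h1 y), e * (k * \<zeta>))"
      using h1S[OF yS] ek\<zeta> by (simp add: skew_apply)
    finally show ?thesis by (simp add: e mult_ac)
  qed
  moreover have "h2 (h1 y) \<in> V" if "y \<in> F" for y using h2(2) that by blast
  ultimately show ?thesis using g by blast
qed

end

section \<open>The flow is a PI-flow\<close>

lemma openin_slice:
  assumes "openin Y W" and "\<omega> \<in> sphere 0 1"
  shows "openin S2 {z \<in> sphere 0 1. (z, \<omega>) \<in> W}"
proof -
  have "continuous_map S2 Y (\<lambda>z. (z, \<omega>))"
    using assms(2) by (simp add: continuous_map_pairedI)
  then have "openin S2 {z \<in> topspace S2. (z, \<omega>) \<in> W}"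
    using assms(1) by (rule openin_continuous_map_preimage)
  then show ?thesis by simp
qed

text \<open>By compactness of the diagonal, its neighbourhoods contain metric ones.\<close>

lemma diagonal_nhd_Y:
  assumes "diagonal_nhd Y \<alpha>"
  obtains e where "0 < e"
    and "\<And>p q. p \<in> topspace Y \<Longrightarrow> q \<in> topspace Y \<Longrightarrow> dist p q < e \<Longrightarrow> (p, q) \<in> \<alpha>"
proof -
  obtain U where U: "openin (prod_topology Y Y) U" "\<And>x. x \<in> topspace Y \<Longrightarrow> (x, x) \<in> U" "U \<subseteq> \<alpha>"
    using assms unfolding diagonal_nhd_def by blast
  let ?D = "sphere 0 1 \<times> sphere 0 1 :: ((real ^ 3) \<times> complex) set"
  have "prod_topology Y Y = top_of_set (?D \<times> ?D)"
    by (simp add: prod_topology_subtopology_eu)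
  then obtain W where W: "open W" "U = (?D \<times> ?D) \<inter> W"
    using U(1) by (auto simp: openin_open)
  have "compact ((\<lambda>x. (x, x)) ` ?D)"
    by (intro compact_continuous_image continuous_intros compact_Times) auto
  moreover note W(1)
  moreover have "(\<lambda>x. (x, x)) ` ?D \<subseteq> W" using U(2) W by auto
  ultimately obtain e where e: "0 < e" "(\<Union>x\<in>(\<lambda>x. (x, x)) ` ?D. ball x e) \<subseteq> W"
    by (rule compact_subset_open_imp_ball_epsilon_subset)
  show ?thesis
  proof (rule that[OF e(1)])
    fix p q assume pq: "p \<in> topspace Y" "q \<in> topspace Y" "dist p q < e"
    have "(p, q) \<in> ball (p, p) e" using pq by (simp add: dist_Pair_Pair)
    then have "(p, q) \<in> W" using e(2) pq by force
    then show "(p, q) \<in> \<alpha>" using U(3) W(2) pq by auto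
  qed
qed

context
  fixes \<phi> :: "real ^ 3 \<Rightarrow> real" and U1 U2 :: "(real ^ 3) set"
  assumes \<phi>: "continuous_map S2 (top_of_set {0..1}) \<phi>"
    and U1: "openin S2 U1" "U1 \<noteq> {}" "\<And>y. y \<in> U1 \<Longrightarrow> \<phi> y = 1"
    and U2: "openin S2 U2" "U2 \<noteq> {}" "\<And>y. y \<in> U2 \<Longrightarrow> \<phi> y = 0"
begin

text \<open>A single point of the sphere can be moved into any open set, and the rotation that is
  performed on the way turns \<open>\<zeta>\<close> into the prescribed \<open>\<omega>\<close>.\<close>

lemma minimal_flow_Y: "minimal_flow (GY \<phi>) (GY_topology \<phi>) Y (\<lambda>g. g)"
proof -
  have flow: "flow (GY \<phi>) (GY_topology \<phi>) Y (\<lambda>g. g)"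
    unfolding GY_topology_def GY_eq using compact_space_Y Hausdorff_space_Y by (rule flow_subgroup_of_Homeo)
  have ne: "(sphere 0 1 :: (real ^ 3) set) \<noteq> {}" "(sphere 0 1 :: complex set) \<noteq> {}"
    by simp_all
  have "Y closure_of {g x | g. g \<in> carrier (GY \<phi>)} = topspace Y" if x: "x \<in> topspace Y" for x
  proof (intro equalityI closure_of_subset_topspace subsetI)
    fix q assume q: "q \<in> topspace Y"
    obtain y \<zeta> where y: "x = (y, \<zeta>)" "y \<in> sphere 0 1" "\<zeta> \<in> sphere 0 1" using x by auto
    obtain z \<omega> where z: "q = (z, \<omega>)" "z \<in> sphere 0 1" "\<omega> \<in> sphere 0 1" using q by auto
    show "q \<in> Y closure_of {g x | g. g \<in> carrier (GY \<phi>)}"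
      unfolding in_closure_of
    proof (intro conjI allI impI q)
      fix W assume W: "q \<in> W \<and> openin Y W"
      let ?V = "{v \<in> sphere 0 1. (v, \<omega>) \<in> W}"
      have "norm (\<omega> / \<zeta>) = 1" using y z by (simp add: norm_divide)
      moreover have "openin S2 ?V" using W z by (intro openin_slice) auto
      moreover have "?V \<noteq> {}" using W z by auto
      ultimately obtain g where g: "g \<in> carrier (GY \<phi>)"
        and gv: "\<forall>y\<in>{y}. \<exists>v\<in>?V. \<forall>\<zeta>'\<in>sphere 0 1. g (y, \<zeta>') = (v, \<omega> / \<zeta> * (if y \<in> {} then - 1 else 1) * \<zeta>')"
        using GY_collapses[OF \<phi> U1 U2, of "{y}" ?V "\<omega> / \<zeta>" "{}"] y by auto
      have "\<zeta> \<noteq> 0" using y by auto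
      obtain v where "v \<in> ?V" "g (y, \<zeta>) = (v, \<omega> / \<zeta> * 1 * \<zeta>)" using gv y by auto
      then have "g x \<in> W" using \<open>\<zeta> \<noteq> 0\<close> y by simp
      then show "\<exists>y. y \<in> {g x | g. g \<in> carrier (GY \<phi>)} \<and> y \<in> W" using g by blast
    qed
  qed
  then show ?thesis using flow ne by (simp add: minimal_flow_def)
qed

text \<open>The tower is \<open>Y \<rightarrow> S2 \<rightarrow> pt\<close>. The lower map is proximal because any two points of the sphere
  can be moved into any open set simultaneously; the upper one is equicontinuous because the group
  moves the fibres isometrically. The top of the tower is a copy of \<open>Y\<close>, so that the proximal
  homomorphism onto \<open>Y\<close> is an isomorphism.\<close>

lemma PI_flow_Y: "PI_flow (GY \<phi>) (GY_topology \<phi>) Y (\<lambda>g. g)"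
proof -
  let ?G = "GY \<phi>" and ?T = "GY_topology \<phi>"
  \<comment> \<open>Points are represented in the type of sets of sets of self-maps by means of constant maps; a point of the sphere by the point \<open>1\<close> of the fibre over it.\<close>
  define e2 :: "(real ^ 3) \<times> complex \<Rightarrow> ((real ^ 3) \<times> complex \<Rightarrow> (real ^ 3) \<times> complex) set set"
    where "e2 = (\<lambda>p. {{\<lambda>_. p}})"
  define e1 :: "real ^ 3 \<Rightarrow> ((real ^ 3) \<times> complex \<Rightarrow> (real ^ 3) \<times> complex) set set"
    where "e1 = (\<lambda>y. {{\<lambda>_. (y, 1)}})"
  define e0 :: "((real ^ 3) \<times> complex \<Rightarrow> (real ^ 3) \<times> complex) set set" where "e0 = {}"
  have "inj_on e2 (topspace Y)" by (auto simp: inj_on_def e2_def fun_eq_iff)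
  then obtain Z2 where Z2: "homeomorphic_maps Y Z2 e2 (inv_into (topspace Y) e2)"
    "topspace Z2 = e2 ` topspace Y" by (rule ex_homeomorphic_copy)
  have "inj_on e1 (topspace S2)" by (auto simp: inj_on_def e1_def fun_eq_iff)
  then obtain Z1 where Z1: "homeomorphic_maps S2 Z1 e1 (inv_into (topspace S2) e1)"
    "topspace Z1 = e1 ` topspace S2" by (rule ex_homeomorphic_copy)
  define d2 where "d2 = inv_into (topspace Y) e2"
  define d1 where "d1 = inv_into (topspace S2) e1"
  define Z0 where "Z0 = discrete_topology {e0}"
  have d2: "d2 (e2 p) = p" if "p \<in> topspace Y" for p
    using Z2(1) that unfolding homeomorphic_maps_def d2_def by blast
  have d1: "d1 (e1 y) = y" if "y \<in> sphere 0 1" for y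
    using Z1 that by (simp add: homeomorphic_maps_def d1_def)
  have e2_cont: "continuous_map Y Z2 e2" and d2_cont: "continuous_map Z2 Y d2"
    using Z2 by (simp_all add: homeomorphic_maps_def d2_def)
  have e1_cont: "continuous_map S2 Z1 e1"
    using Z1 by (simp add: homeomorphic_maps_def)
  have homeo: "Y homeomorphic_space Z2" "S2 homeomorphic_space Z1"
    using Z1(1) Z2(1) by (auto simp: homeomorphic_space_def)
  have H2: "Hausdorff_space Z2"
    using homeomorphic_Hausdorff_space[OF homeo(1)] Hausdorff_space_Y by blast
  have H1: "Hausdorff_space Z1"
    using homeomorphic_Hausdorff_space[OF homeo(2)] by (simp add: Hausdorff_space_subtopology)
  define a2 where "a2 = (\<lambda>g w. e2 (g (d2 w)))"
  define a1 where "a1 = (\<lambda>g w. e1 (fst ((g :: (real ^ 3) \<times> complex \<Rightarrow> (real ^ 3) \<times> complex) (d1 w, 1))))"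
  define a0 where "a0 = (\<lambda>(g :: (real ^ 3) \<times> complex \<Rightarrow> (real ^ 3) \<times> complex)
    (w :: ((real ^ 3) \<times> complex \<Rightarrow> (real ^ 3) \<times> complex) set set). w)"
  have flow: "flow ?G ?T Y (\<lambda>g. g)" using minimal_flow_Y by (simp add: minimal_flow_def)
  have closed: "g p \<in> topspace Y" if "g \<in> carrier ?G" "p \<in> topspace Y" for g p
    using flow_closed[OF flow that] .
  have one: "(1 :: complex) \<in> sphere 0 1" by simp
  have act1: "e1 (fst (g p)) = a1 g (e1 (fst p))" if g: "g \<in> carrier ?G" and pY: "p \<in> topspace Y" for g p
  proof -
    obtain y \<zeta> where p: "p = (y, \<zeta>)" "y \<in> sphere 0 1" "\<zeta> \<in> sphere 0 1" using pY by auto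
    then show ?thesis using fst_GY[OF \<phi> g p(2,3) one] by (simp add: a1_def d1)
  qed
  have m2: "minimal_flow ?G ?T Z2 a2"
    using minimal_flow_Y e2_cont Z2(2)[symmetric] H2
    by (rule minimal_flow_factor) (simp only: a2_def d2)
  have "continuous_map Y Z1 (e1 \<circ> fst)"
    using continuous_map_fst e1_cont by (rule continuous_map_compose)
  moreover have "(e1 \<circ> fst) ` topspace Y = topspace Z1"
    unfolding Z1(2) image_comp[symmetric] topspace_Y by simp
  ultimately have m1: "minimal_flow ?G ?T Z1 a1"
    using minimal_flow_Y H1 by (intro minimal_flow_factor[of ?G ?T Y "\<lambda>g. g" Z1 "e1 \<circ> fst"])
      (simp_all add: act1 del: topspace_prod_topology)
  have "continuous_map Y Z0 (\<lambda>_. e0)" by (simp add: Z0_def)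
  moreover have "topspace Y \<noteq> {}"
    using minimal_flow_Y unfolding minimal_flow_def by blast
  then have "(\<lambda>_. e0) ` topspace Y = topspace Z0"
    by (simp only: Z0_def topspace_discrete_topology image_constant_conv if_False)
  ultimately have m0: "minimal_flow ?G ?T Z0 a0"
    using minimal_flow_Y by (intro minimal_flow_factor[of ?G ?T Y "\<lambda>g. g" Z0 "\<lambda>_. e0"])
      (simp_all add: a0_def Z0_def)

  have prox: "proximal_extension ?G Z1 a1 Z0 a0 (\<lambda>_. e0)"
    unfolding proximal_extension_def flow_hom_def
  proof (intro conjI ballI impI)
    fix w1 w2 assume w: "w1 \<in> topspace Z1" "w2 \<in> topspace Z1"
    then obtain y1 y2 where y: "w1 = e1 y1" "y1 \<in> sphere 0 1" "w2 = e1 y2" "y2 \<in> sphere 0 1"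
      by (auto simp: Z1(2))
    show "proximal_points ?G Z1 a1 w1 w2"
    proof (rule proximal_pointsI[OF w(1)])
      fix V assume V: "openin Z1 V" "w1 \<in> V"
      let ?V = "{y \<in> topspace S2. e1 y \<in> V}"
      have "openin S2 ?V" using e1_cont V(1) by (rule openin_continuous_map_preimage)
      moreover have "?V \<noteq> {}" using V y by auto
      ultimately obtain g where g: "g \<in> carrier ?G"
        and gv: "\<forall>y\<in>{y1, y2}. \<exists>v\<in>?V. \<forall>\<zeta>\<in>sphere 0 1. g (y, \<zeta>) = (v, 1 * (if y \<in> {} then - 1 else 1) * \<zeta>)"
        using GY_collapses[OF \<phi> U1 U2, of "{y1, y2}" ?V 1 "{}"] y by auto
      have "e1 (fst (g (y, 1))) \<in> V" if "y \<in> {y1, y2}" for y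
        using gv that by force
      then have "a1 g w1 \<in> V \<and> a1 g w2 \<in> V"
        using y by (simp add: a1_def d1)
      then show "\<exists>g\<in>carrier ?G. a1 g w1 \<in> V \<and> a1 g w2 \<in> V" using g by blast
    qed
  qed (simp_all add: Z0_def a0_def)

  have eqc: "equicontinuous_extension ?G Z2 a2 Z1 a1 (\<lambda>w. e1 (fst (d2 w)))"
    unfolding equicontinuous_extension_def
  proof (intro conjI allI impI)
    have d2_closed: "d2 w \<in> topspace Y" if "w \<in> topspace Z2" for w
      using that d2 by (auto simp: Z2(2))
    show "flow_hom ?G Z2 a2 Z1 a1 (\<lambda>w. e1 (fst (d2 w)))"
      unfolding flow_hom_def
    proof (intro conjI ballI)
      show "continuous_map Z2 Z1 (\<lambda>w. e1 (fst (d2 w)))"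
        using continuous_map_compose[OF continuous_map_compose[OF d2_cont continuous_map_fst] e1_cont]
        by (simp add: o_def)
      fix g w assume g: "g \<in> carrier ?G" and w: "w \<in> topspace Z2"
      show "e1 (fst (d2 (a2 g w))) = a1 g (e1 (fst (d2 w)))"
        using act1[OF g d2_closed[OF w]] d2[OF closed[OF g d2_closed[OF w]]] by (simp add: a2_def)
    qed
    fix \<alpha> assume \<alpha>: "diagonal_nhd Z2 \<alpha>"
    then obtain U where U: "openin (prod_topology Z2 Z2) U" "\<And>w. w \<in> topspace Z2 \<Longrightarrow> (w, w) \<in> U" "U \<subseteq> \<alpha>"
      unfolding diagonal_nhd_def by blast
    define \<alpha>' where "\<alpha>' = {pq \<in> topspace (prod_topology Y Y). (e2 (fst pq), e2 (snd pq)) \<in> U}"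
    have "continuous_map (prod_topology Y Y) (prod_topology Z2 Z2) (\<lambda>pq. (e2 (fst pq), e2 (snd pq)))"
      using continuous_map_compose[OF continuous_map_fst e2_cont] continuous_map_compose[OF continuous_map_snd e2_cont]
      by (intro continuous_map_pairedI) (simp_all add: o_def)
    then have "openin (prod_topology Y Y) \<alpha>'"
      unfolding \<alpha>'_def using U(1) by (rule openin_continuous_map_preimage)
    moreover have "(p, p) \<in> \<alpha>'" if "p \<in> topspace Y" for p
      using that U(2)[of "e2 p"] Z2(2) by (simp add: \<alpha>'_def)
    moreover have "\<alpha>' \<subseteq> topspace Y \<times> topspace Y"
      by (auto simp: \<alpha>'_def)
    ultimately have "diagonal_nhd Y \<alpha>'"
      unfolding diagonal_nhd_def by blast
    then obtain e where e: "0 < e"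
      "\<And>p q. p \<in> topspace Y \<Longrightarrow> q \<in> topspace Y \<Longrightarrow> dist p q < e \<Longrightarrow> (p, q) \<in> \<alpha>'"
      using diagonal_nhd_Y[of \<alpha>' thesis] by simp
    \<comment> \<open>The metric neighbourhood of radius \<open>e\<close>, read in the copy \<open>Z2\<close>.\<close>
    define \<beta> where "\<beta> = {ww \<in> topspace (prod_topology Z2 Z2). dist (d2 (fst ww)) (d2 (snd ww)) \<in> {..<e}}"
    have "continuous_map (prod_topology Z2 Z2) euclidean (\<lambda>ww. dist (d2 (fst ww)) (d2 (snd ww)))"
    proof -
      have d2_eu: "continuous_map Z2 euclidean d2"
        using d2_cont by (simp add: prod_topology_subtopology_eu continuous_map_in_subtopology)
      have pair: "continuous_map (prod_topology Z2 Z2) (prod_topology euclidean euclidean)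
          (\<lambda>ww. (d2 (fst ww), d2 (snd ww)))"
        using continuous_map_compose[OF continuous_map_fst d2_eu] continuous_map_compose[OF continuous_map_snd d2_eu]
        by (intro continuous_map_pairedI) (simp_all add: o_def)
      have "continuous_on UNIV (\<lambda>pq :: ((real ^ 3) \<times> complex) \<times> ((real ^ 3) \<times> complex). dist (fst pq) (snd pq))"
        by (intro continuous_intros)
      then have "continuous_map (prod_topology euclidean euclidean) euclidean
          (\<lambda>pq :: ((real ^ 3) \<times> complex) \<times> ((real ^ 3) \<times> complex). dist (fst pq) (snd pq))"
        by simp
      from continuous_map_compose[OF pair this] show ?thesis by (simp add: o_def)
    qed
    then have "openin (prod_topology Z2 Z2) \<beta>"
      unfolding \<beta>_def by (rule openin_continuous_map_preimage) simp
    moreover have "(w, w) \<in> \<beta>" if "w \<in> topspace Z2" for w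
      using that e(1) by (simp add: \<beta>_def)
    moreover have "\<beta> \<subseteq> topspace Z2 \<times> topspace Z2"
      by (auto simp: \<beta>_def)
    ultimately have "diagonal_nhd Z2 \<beta>"
      unfolding diagonal_nhd_def by blast
    moreover have "(a2 g w, a2 g w') \<in> \<alpha>"
      if g: "g \<in> carrier ?G" and w: "(w, w') \<in> \<beta>" and eq: "e1 (fst (d2 w)) = e1 (fst (d2 w'))" for g w w'
    proof -
      have p: "d2 w \<in> topspace Y" "d2 w' \<in> topspace Y" and de: "dist (d2 w) (d2 w') < e"
        using w d2_closed[of w] d2_closed[of w'] by (auto simp: \<beta>_def)
      have "fst (d2 w) = fst (d2 w')"
        using eq by (simp add: e1_def fun_eq_iff)
      then have "dist (g (d2 w)) (g (d2 w')) < e"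
        using dist_GY_fibre[OF \<phi> g p] de by simp
      then have "(g (d2 w), g (d2 w')) \<in> \<alpha>'"
        using e(2) closed[OF g p(1)] closed[OF g p(2)] by blast
      then show ?thesis using U(3) by (auto simp: \<alpha>'_def a2_def)
    qed
    ultimately show "\<exists>\<beta>. diagonal_nhd Z2 \<beta> \<and> (\<forall>g\<in>carrier ?G. \<forall>(w, w')\<in>\<beta>.
        e1 (fst (d2 w)) = e1 (fst (d2 w')) \<longrightarrow> (a2 g w, a2 g w') \<in> \<alpha>)"
      by blast
  qed

  have "strictly_PI ?G ?T Z2 a2"
    by (rule strictly_PI_two_steps[of "{}" "{{}}" "{UNIV}", OF _ _ _ m0 _ m1 m2 prox eqc])
      (simp_all add: Z0_def)
  moreover have "proximal_extension ?G Z2 a2 Y (\<lambda>g. g) d2"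
    unfolding proximal_extension_def flow_hom_def
  proof (intro conjI ballI impI)
    fix g w assume g: "g \<in> carrier ?G" and w: "w \<in> topspace Z2"
    have "d2 w \<in> topspace Y" using continuous_map_image_subset_topspace[OF d2_cont] w by blast
    then show "d2 (a2 g w) = g (d2 w)"
      using d2[OF closed[OF g]] by (simp only: a2_def)
  next
    fix w1 w2 assume w: "w1 \<in> topspace Z2" "w2 \<in> topspace Z2" and "d2 w1 = d2 w2"
    then have "w1 = w2" using Z2(1) unfolding homeomorphic_maps_def d2_def by metis
    then show "proximal_points ?G Z2 a2 w1 w2"
      using proximal_points_refl[of ?G ?T Z2 a2] m2 w by (simp add: minimal_flow_def)
  qed (rule d2_cont)
  ultimately show ?thesis
    unfolding PI_flow_def using minimal_flow_Y by blast
qed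

end

section \<open>The minimal left ideals\<close>

text \<open>Minimal left ideals are pairwise disjoint, so that there are at most as many of them as there
  are maps in the enveloping semigroup.\<close>

lemma minimal_left_ideals_lepoll:
  "{I. minimal_left_ideal G X a I} \<lesssim> enveloping_semigroup G X a"
proof -
  have ideal: "left_ideal G X a I" if "minimal_left_ideal G X a I" for I
    using that by (simp add: minimal_left_ideal_def)
  have eq: "I = J" if IJ: "minimal_left_ideal G X a I" "minimal_left_ideal G X a J" "p \<in> I" "p \<in> J" for I J p
  proof -
    have "left_ideal G X a (I \<inter> J)"
      using ideal[OF IJ(1)] ideal[OF IJ(2)] IJ(3,4) unfolding left_ideal_def by blast
    then have "I \<inter> J = I" "I \<inter> J = J"
      using IJ unfolding minimal_left_ideal_def by blast+
    then show "I = J" by simp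
  qed
  have "\<exists>p. p \<in> I" if "minimal_left_ideal G X a I" for I
    using ideal[OF that] unfolding left_ideal_def by blast
  then obtain f where f: "\<And>I. minimal_left_ideal G X a I \<Longrightarrow> f I \<in> I" by metis
  have "inj_on f {I. minimal_left_ideal G X a I}"
    using f eq by (intro inj_onI) (metis mem_Collect_eq)
  moreover have "f ` {I. minimal_left_ideal G X a I} \<subseteq> enveloping_semigroup G X a"
  proof (rule image_subsetI)
    fix I assume "I \<in> {I. minimal_left_ideal G X a I}"
    then have I: "minimal_left_ideal G X a I" by simp
    show "f I \<in> enveloping_semigroup G X a"
      using f[OF I] ideal[OF I] unfolding left_ideal_def by blast
  qed
  ultimately show ?thesis unfolding lepoll_def by blast
qed

text \<open>A point is determined by the members of a countable base that contain it.\<close>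

lemma euclidean_space_lepoll_nat_sets: "(UNIV :: 'a::euclidean_space set) \<lesssim> (UNIV :: nat set set)"
proof -
  obtain B :: "nat \<Rightarrow> 'a set" where "inj B" "\<And>n. open (B n)"
    and B: "\<And>S. open S \<Longrightarrow> \<exists>k. S = \<Union>{B n | n. n \<in> k}"
    by (rule univ_second_countable_sequence) (rule that)
  have "inj (\<lambda>x. {n. x \<in> B n})"
  proof (rule injI, rule ccontr)
    fix x y :: 'a assume eq: "{n. x \<in> B n} = {n. y \<in> B n}" and "x \<noteq> y"
    then obtain U where U: "open U" "x \<in> U" "y \<notin> U" using t1_space by blast
    then obtain k where k: "U = \<Union>{B n | n. n \<in> k}" using B by blast
    then obtain n where "n \<in> k" "x \<in> B n" using U(2) by blast
    then have "y \<in> U" using eq k by blast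
    then show False using U(3) by blast
  qed
  then show ?thesis unfolding lepoll_def by blast
qed

text \<open>A map is determined by its graph.\<close>

lemma self_maps_lepoll_Pow_nat_sets:
  "(UNIV :: ('a::euclidean_space \<Rightarrow> 'a) set) \<lesssim> (UNIV :: nat set set set)"
proof -
  obtain j :: "'a \<times> 'a \<Rightarrow> nat set" where j: "inj j"
    using euclidean_space_lepoll_nat_sets[where 'a = "'a \<times> 'a"] unfolding lepoll_def by blast
  have "inj (\<lambda>p :: 'a \<Rightarrow> 'a. j ` range (\<lambda>x. (x, p x)))"
  proof (rule injI)
    fix p q :: "'a \<Rightarrow> 'a" assume "j ` range (\<lambda>x. (x, p x)) = j ` range (\<lambda>x. (x, q x))"
    then have "range (\<lambda>x. (x, p x)) = range (\<lambda>x. (x, q x))"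
      using j by (simp add: inj_image_eq_iff)
    then show "p = q" by (auto simp: fun_eq_iff set_eq_iff)
  qed
  then show ?thesis unfolding lepoll_def by blast
qed

text \<open>The pointwise limit of group elements that change the sign of the fibre coordinate over the
  points of \<open>A\<close>, contract the sphere to the point \<open>z\<close>, and rotate all fibres by \<open>k\<close>. No continuity
  is left: \<open>A\<close> is an arbitrary set, which is why there are so many of these limits.\<close>

definition collapse :: "(real ^ 3) set \<Rightarrow> real ^ 3 \<Rightarrow> complex \<Rightarrow> (real ^ 3) \<times> complex \<Rightarrow> (real ^ 3) \<times> complex" where
  "collapse A z k = (\<lambda>(y, \<zeta>) \<in> topspace Y. (z, k * (if y \<in> A then - 1 else 1) * \<zeta>))"

definition collapses :: "(real ^ 3) set \<Rightarrow> ((real ^ 3) \<times> complex \<Rightarrow> (real ^ 3) \<times> complex) set" where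
  "collapses A = {collapse A z k | z k. z \<in> sphere 0 1 \<and> norm k = 1}"

lemma collapse_apply:
  "y \<in> sphere 0 1 \<Longrightarrow> \<zeta> \<in> sphere 0 1 \<Longrightarrow>
    collapse A z k (y, \<zeta>) = (z, k * (if y \<in> A then - 1 else 1) * \<zeta>)"
  by (simp add: collapse_def)

lemma collapse_closed:
  "z \<in> sphere 0 1 \<Longrightarrow> norm k = 1 \<Longrightarrow> p \<in> topspace Y \<Longrightarrow> collapse A z k p \<in> topspace Y"
  by (auto simp: collapse_def norm_mult)

text \<open>An element of the ideal determines its sign function only up to a constant \<open>k\<close>; a point
  \<open>N\<close> outside both sets fixes the constant.\<close>

lemma collapses_inj:
  assumes N: "N \<in> sphere 0 1 - A" "N \<notin> B" and A: "A \<subseteq> sphere 0 1" and B: "B \<subseteq> sphere 0 1"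
    and eq: "collapses A = collapses B"
  shows "A = B"
proof -
  have "collapse A N 1 \<in> collapses B"
    using N eq by (force simp: collapses_def)
  then obtain z k where zk: "collapse A N 1 = collapse B z k" unfolding collapses_def by blast
  have val: "(if y \<in> A then - 1 else 1 :: complex) = k * (if y \<in> B then - 1 else 1)"
    if "y \<in> sphere 0 1" for y
    using fun_cong[OF zk, of "(y, 1)"] collapse_apply[OF that, of 1] by simp
  have "k = 1" using val[of N] N by simp
  then have "y \<in> A \<longleftrightarrow> y \<in> B" if "y \<in> sphere 0 1" for y
    using val[OF that] by (simp split: if_splits)
  then show ?thesis using A B by blast
qed

context
  fixes \<phi> :: "real ^ 3 \<Rightarrow> real" and U1 U2 :: "(real ^ 3) set"
  assumes \<phi>: "continuous_map S2 (top_of_set {0..1}) \<phi>"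
    and U1: "openin S2 U1" "U1 \<noteq> {}" "\<And>y. y \<in> U1 \<Longrightarrow> \<phi> y = 1"
    and U2: "openin S2 U2" "U2 \<noteq> {}" "\<And>y. y \<in> U2 \<Longrightarrow> \<phi> y = 0"
begin

abbreviation E where "E \<equiv> enveloping_semigroup (GY \<phi>) Y (\<lambda>g. g)"

text \<open>A basic neighbourhood of the collapse restricts the values at the finitely many points in \<open>P\<close>
  only. The values \<open>\<omega> i\<close> of the fibre coordinate are attained exactly by group elements, and \<open>V\<close> is
  the set of positions on the sphere that are allowed at all points of \<open>P\<close>.\<close>

lemma collapse_in_E:
  assumes z: "z \<in> sphere 0 1" and k: "norm k = 1"
  shows "collapse A z k \<in> E"
  unfolding enveloping_semigroup_def in_closure_of
proof (intro conjI allI impI)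
  show "collapse A z k \<in> topspace (product_topology (\<lambda>_. Y) (topspace Y))"
    using collapse_closed[OF z k] unfolding topspace_product_topology
    by (auto simp: PiE_iff collapse_def)
  fix T assume T: "collapse A z k \<in> T \<and> openin (product_topology (\<lambda>_. Y) (topspace Y)) T"
  then obtain O' where fin: "finite {i \<in> topspace Y. O' i \<noteq> topspace Y}"
    and op: "\<And>i. i \<in> topspace Y \<Longrightarrow> openin Y (O' i)"
    and mem: "collapse A z k \<in> Pi\<^sub>E (topspace Y) O'" and sub: "Pi\<^sub>E (topspace Y) O' \<subseteq> T"
    unfolding openin_product_topology_alt by meson
  define P where "P = {i \<in> topspace Y. O' i \<noteq> topspace Y}"
  define \<omega> where "\<omega> i = snd (collapse A z k i)" for i
  have \<omega>: "\<omega> i \<in> sphere 0 1" if "i \<in> topspace Y" for i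
    using collapse_closed[OF z k that, of A] by (simp add: \<omega>_def mem_Times_iff)
  define V where "V = sphere 0 1 \<inter> (\<Inter>i\<in>P. {v \<in> sphere 0 1. (v, \<omega> i) \<in> O' i})"
  have "openin S2 (\<Inter>(insert (sphere 0 1) ((\<lambda>i. {v \<in> sphere 0 1. (v, \<omega> i) \<in> O' i}) ` P)))"
  proof (rule openin_Inter)
    have slice: "openin S2 {v \<in> sphere 0 1. (v, \<omega> i) \<in> O' i}" if "i \<in> P" for i
    proof -
      have i: "i \<in> topspace Y" using that by (simp add: P_def)
      show ?thesis using op[OF i] \<omega>[OF i] by (rule openin_slice)
    qed
    have "openin S2 (sphere 0 1)" by simp
    then show "openin S2 T" if "T \<in> insert (sphere 0 1) ((\<lambda>i. {v \<in> sphere 0 1. (v, \<omega> i) \<in> O' i}) ` P)" for T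
      using that slice by blast
    show "finite (insert (sphere 0 1) ((\<lambda>i. {v \<in> sphere 0 1. (v, \<omega> i) \<in> O' i}) ` P))"
      using fin by (simp only: P_def[symmetric] finite_insert finite_imageI)
  qed simp
  then have V: "openin S2 V" by (simp add: V_def)
  have "(z, \<omega> i) \<in> O' i" if "i \<in> topspace Y" for i
  proof -
    have "collapse A z k i = (z, \<omega> i)" using that by (auto simp: \<omega>_def collapse_def)
    then show ?thesis using PiE_mem[OF mem that] by (simp only:)
  qed
  then have "z \<in> V" using z by (auto simp: V_def P_def)
  then have Vne: "V \<noteq> {}" by blast
  have F: "finite (fst ` P)" "fst ` P \<subseteq> sphere 0 1" using fin by (auto simp: P_def)
  obtain g where g: "g \<in> carrier (GY \<phi>)"
    and gv: "\<And>y. y \<in> fst ` P \<Longrightarrow> \<exists>v\<in>V. \<forall>\<zeta>\<in>sphere 0 1. g (y, \<zeta>) = (v, k * (if y \<in> A then - 1 else 1) * \<zeta>)"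
    using GY_collapses[OF \<phi> U1 U2 F V Vne k, of A] by blast
  have flow: "flow (GY \<phi>) (GY_topology \<phi>) Y (\<lambda>g. g)"
    using minimal_flow_Y[OF \<phi> U1 U2] by (simp add: minimal_flow_def)
  have "restrict g (topspace Y) i \<in> O' i" if i: "i \<in> topspace Y" for i
  proof (cases "i \<in> P")
    case True
    obtain y \<zeta> where y: "i = (y, \<zeta>)" "y \<in> sphere 0 1" "\<zeta> \<in> sphere 0 1" using i by auto
    then obtain v where v: "v \<in> V" "g i = (v, k * (if y \<in> A then - 1 else 1) * \<zeta>)"
    proof -
      have "y \<in> fst ` P" using True y(1) by force
      then show ?thesis using gv[of y] y that by blast
    qed
    have "\<omega> i = k * (if y \<in> A then - 1 else 1) * \<zeta>"
      using y by (simp add: \<omega>_def collapse_apply)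
    then have "g i \<in> O' i" using v True by (auto simp: V_def)
    then show ?thesis using i by simp
  next
    case False
    then show ?thesis using i flow_closed[OF flow g i] by (simp add: P_def)
  qed
  then have "restrict g (topspace Y) \<in> Pi\<^sub>E (topspace Y) O'" by (simp add: PiE_iff)
  then show "\<exists>f. f \<in> {restrict g (topspace Y) | g. g \<in> carrier (GY \<phi>)} \<and> f \<in> T"
    using g sub by blast
qed

lemma E_closed: "q \<in> E \<Longrightarrow> p \<in> topspace Y \<Longrightarrow> q p \<in> topspace Y"
proof -
  assume q: "q \<in> E" and p: "p \<in> topspace Y"
  have "q \<in> topspace (product_topology (\<lambda>_. Y) (topspace Y))"
    using q unfolding enveloping_semigroup_def by (rule subsetD[OF closure_of_subset_topspace])
  then have "q \<in> Pi\<^sub>E (topspace Y) (\<lambda>_. topspace Y)" by (simp only: topspace_product_topology o_def)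
  then show "q p \<in> topspace Y" using p by (rule PiE_mem)
qed

text \<open>The group commutes with the rotations, and the condition to do so is closed under pointwise
  limits.\<close>

lemma E_commutes_rotation:
  assumes q: "q \<in> E" and z: "z \<in> sphere 0 1" and \<zeta>: "\<zeta> \<in> sphere 0 1" and k: "norm k = 1"
  shows "q (z, k * \<zeta>) = (fst (q (z, \<zeta>)), k * snd (q (z, \<zeta>)))"
proof -
  let ?P = "product_topology (\<lambda>_. Y) (topspace Y)"
  let ?r = "skew \<one>\<^bsub>Homeo S2\<^esub> (\<lambda>_. k)"
  interpret group "Homeo S2" by (rule group_Homeo)
  have r: "?r p = (fst p, k * snd p)" if "p \<in> topspace Y" for p
    using that by (auto simp: skew_def one_Homeo)
  have in1: "(z, k * \<zeta>) \<in> topspace Y" and in2: "(z, \<zeta>) \<in> topspace Y"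
    using z \<zeta> k by (simp_all add: norm_mult)
  have c1: "continuous_map ?P Y (\<lambda>f. f (z, k * \<zeta>))"
    using in1 by (rule continuous_map_product_projection)
  have "continuous_map ?P Y (\<lambda>f. f (z, \<zeta>))"
    using in2 by (rule continuous_map_product_projection)
  then have c2: "continuous_map ?P Y (\<lambda>f. ?r (f (z, \<zeta>)))"
    using continuous_map_compose[OF _ continuous_map_skew[OF one_closed cocycle_const[OF k]],
        of ?P "\<lambda>f. f (z, \<zeta>)"] by (simp only: o_def)
  have closed: "closedin ?P {f \<in> topspace ?P. f (z, k * \<zeta>) = ?r (f (z, \<zeta>))}"
    using Hausdorff_space_Y c1 c2 by (rule closedin_continuous_maps_eq)
  have flow: "flow (GY \<phi>) (GY_topology \<phi>) Y (\<lambda>g. g)"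
    using minimal_flow_Y[OF \<phi> U1 U2] by (simp add: minimal_flow_def)
  have "restrict g (topspace Y) \<in> {f \<in> topspace ?P. f (z, k * \<zeta>) = ?r (f (z, \<zeta>))}"
    if g: "g \<in> carrier (GY \<phi>)" for g
  proof -
    have "restrict g (topspace Y) \<in> topspace ?P"
      unfolding topspace_product_topology using flow_closed[OF flow g] by (simp only: restrict_PiE_iff ball_simps) blast
    moreover have "g (z, k * \<zeta>) = ?r (g (z, \<zeta>))"
      using GY_commutes_rotation[OF \<phi> g z \<zeta> k] r[OF flow_closed[OF flow g in2]] by simp
    ultimately show ?thesis using in1 in2 by (simp only: mem_Collect_eq restrict_apply' simp_thms)
  qed
  then have "{restrict g (topspace Y) | g. g \<in> carrier (GY \<phi>)} \<subseteq>
      {f \<in> topspace ?P. f (z, k * \<zeta>) = ?r (f (z, \<zeta>))}"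
    by blast
  then have "E \<subseteq> {f \<in> topspace ?P. f (z, k * \<zeta>) = ?r (f (z, \<zeta>))}"
    unfolding enveloping_semigroup_def using closed by (rule closure_of_minimal)
  then have "q (z, k * \<zeta>) = ?r (q (z, \<zeta>))" using q by blast
  then show ?thesis using r[OF E_closed[OF q in2]] by simp
qed

text \<open>A collapse has its image in the fibre over \<open>z\<close>, and a map that commutes with rotations is
  determined on this fibre by its value at \<open>(z, 1)\<close>. In particular composition on the left does not
  change \<open>A\<close>.\<close>

lemma E_compose_collapse:
  assumes q: "q \<in> E" and z: "z \<in> sphere 0 1" and k: "norm k = 1"
  shows "compose (topspace Y) q (collapse A z k) = collapse A (fst (q (z, 1))) (snd (q (z, 1)) * k)"
proof
  fix p
  show "compose (topspace Y) q (collapse A z k) p = collapse A (fst (q (z, 1))) (snd (q (z, 1)) * k) p"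
  proof (cases "p \<in> topspace Y")
    case True
    then obtain y \<zeta> where p: "p = (y, \<zeta>)" "y \<in> sphere 0 1" "\<zeta> \<in> sphere 0 1" by auto
    define m where "m = k * (if y \<in> A then - 1 else 1) * \<zeta>"
    have m: "norm m = 1" using p k by (simp add: m_def norm_mult)
    have "q (z, m * 1) = (fst (q (z, 1)), m * snd (q (z, 1)))"
      using q z m by (intro E_commutes_rotation) auto
    then show ?thesis
      using p True by (simp add: compose_eq collapse_apply m_def mult_ac)
  qed (simp add: compose_def collapse_def)
qed

text \<open>For minimality, any collapse of \<open>A\<close> is turned into any other one by composition with a collapse
  of the empty set.\<close>

lemma minimal_left_ideal_collapses: "minimal_left_ideal (GY \<phi>) Y (\<lambda>g. g) (collapses A)"
  unfolding minimal_left_ideal_def left_ideal_def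
proof (intro conjI allI impI ballI)
  obtain N :: "real ^ 3" where N: "N \<in> sphere 0 1"
    using sphere_eq_empty[of "0 :: real ^ 3" 1] by fastforce
  then have "collapse A N 1 \<in> collapses A"
    unfolding collapses_def using norm_one by blast
  then show "collapses A \<noteq> {}" by blast
  show "collapses A \<subseteq> E" using collapse_in_E by (auto simp: collapses_def)
next
  fix p q assume p: "p \<in> E" and "q \<in> collapses A"
  then obtain z k where q: "q = collapse A z k" "z \<in> sphere 0 1" "norm k = 1"
    by (auto simp: collapses_def)
  have "p (z, 1) \<in> topspace Y" using E_closed[OF p, of "(z, 1)"] q by simp
  then have "fst (p (z, 1)) \<in> sphere 0 1" "norm (snd (p (z, 1)) * k) = 1"
    using q by (auto simp: norm_mult mem_Times_iff)
  then show "compose (topspace Y) p q \<in> collapses A"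
    unfolding q(1) E_compose_collapse[OF p q(2,3)] collapses_def by blast
next
  fix J assume J: "J \<noteq> {} \<and> J \<subseteq> E \<and> (\<forall>p\<in>E. \<forall>q\<in>J. compose (topspace Y) p q \<in> J)"
  show "\<not> J \<subset> collapses A"
  proof
    assume sub: "J \<subset> collapses A"
    then obtain z k where zk: "collapse A z k \<in> J" "z \<in> sphere 0 1" "norm k = 1"
      using J unfolding collapses_def by blast
    have "collapse A z' k' \<in> J" if z': "z' \<in> sphere 0 1" and k': "norm k' = 1" for z' k'
    proof -
      have "k \<noteq> 0" using zk(3) by auto
      have "norm (k' / k) = 1" using zk(3) k' by (simp add: norm_divide)
      then have q: "collapse {} z' (k' / k) \<in> E" using collapse_in_E[OF z'] by blast
      have "compose (topspace Y) (collapse {} z' (k' / k)) (collapse A z k) = collapse A z' k'"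
        unfolding E_compose_collapse[OF q zk(2,3)] using zk(2) \<open>k \<noteq> 0\<close> by (simp add: collapse_apply)
      then show ?thesis using conjunct2[OF conjunct2[OF J]] q zk(1) by metis
    qed
    then have "collapses A \<subseteq> J" unfolding collapses_def by blast
    then show False using sub by blast
  qed
qed

lemma card_minimal_left_ideals:
  "{I. minimal_left_ideal (GY \<phi>) Y (\<lambda>g. g) I} \<approx> Pow (Pow (UNIV :: nat set))"
proof (rule lepoll_antisym)
  have "{I. minimal_left_ideal (GY \<phi>) Y (\<lambda>g. g) I} \<lesssim> E"
    by (rule minimal_left_ideals_lepoll)
  also have "E \<lesssim> (UNIV :: ((real ^ 3) \<times> complex \<Rightarrow> (real ^ 3) \<times> complex) set)"
    by (rule subset_imp_lepoll) simp
  also have "\<dots> \<lesssim> (UNIV :: nat set set set)"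
    by (rule self_maps_lepoll_Pow_nat_sets)
  finally show "{I. minimal_left_ideal (GY \<phi>) Y (\<lambda>g. g) I} \<lesssim> Pow (Pow (UNIV :: nat set))"
    by simp
next
  obtain N :: "real ^ 3" where N: "N \<in> sphere 0 1"
    using sphere_eq_empty[of "0 :: real ^ 3" 1] by fastforce
  obtain s :: "real ^ 3 \<Rightarrow> complex" and s' where s: "homeomorphism (sphere 0 1 - {N}) UNIV s s'"
    using punctured_S2_chart[OF N] .
  have s': "s (s' x) = x" "s' x \<in> sphere 0 1 - {N}" for x
    using s unfolding homeomorphism_def by blast+
  obtain r :: "nat set \<Rightarrow> real" where r: "inj r"
    using eqpoll_imp_lepoll[OF nat_sets_eqpoll_reals] unfolding lepoll_def by blast
  \<comment> \<open>A copy of the continuum in the sphere that misses \<open>N\<close>.\<close>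
  define j where "j x = s' (complex_of_real (r x))" for x
  have j: "inj j"
    using s'(1) r by (intro injI) (metis injD j_def of_real_eq_iff)
  have jS: "j ` A \<subseteq> sphere 0 1 - {N}" for A
    using s'(2) by (auto simp: j_def)
  have "inj (\<lambda>A. collapses (j ` A))"
  proof (rule injI)
    fix A B assume eq: "collapses (j ` A) = collapses (j ` B)"
    have "j ` A = j ` B"
      by (rule collapses_inj[OF _ _ _ _ eq, of N]) (use N jS[of A] jS[of B] in auto)
    then show "A = B" using j by (simp add: inj_image_eq_iff)
  qed
  moreover have "range (\<lambda>A. collapses (j ` A)) \<subseteq> {I. minimal_left_ideal (GY \<phi>) Y (\<lambda>g. g) I}"
    using minimal_left_ideal_collapses by blast
  ultimately show "Pow (Pow (UNIV :: nat set)) \<lesssim> {I. minimal_left_ideal (GY \<phi>) Y (\<lambda>g. g) I}"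
    unfolding lepoll_def by (simp, blast)
qed

end

theorem proposition5p1:
  fixes \<phi> :: "real ^ 3 \<Rightarrow> real" and U1 U2 :: "(real ^ 3) set"
  assumes "openin S2 U1" and "U1 \<noteq> {}"
    and "openin S2 U2" and "U2 \<noteq> {}"
    and "S2 closure_of U1 \<inter> S2 closure_of U2 = {}"
    and "continuous_map S2 (top_of_set {0..1}) \<phi>"
    and "\<And>y. y \<in> U1 \<Longrightarrow> \<phi> y = 1"
    and "\<And>y. y \<in> U2 \<Longrightarrow> \<phi> y = 0"
  shows "PI_flow (GY \<phi>) (GY_topology \<phi>) Y (\<lambda>g x. g x) \<and>
         {I. minimal_left_ideal (GY \<phi>) Y (\<lambda>g x. g x) I} \<approx> Pow (Pow (UNIV :: nat set))"
  using PI_flow_Y[OF assms(6,1,2,7,3,4,8)] card_minimal_left_ideals[OF assms(6,1,2,7,3,4,8)]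
  by blast

end
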